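(* (i) Let $\mathcal A$ be a non-unimodular Lie algebra of dimension $m=2n-1\ge 5$, let $(\Lambda,\Lambda_1)$ be a linear Poisson pair on the dual space $\mathcal A^*$, and let $p\in\mathcal A^*$. If $(\Lambda,\Lambda_1)$ is generic and flat at $p$, then for every $a\in\mathbb K\setminus\{0\}$ the linear Poisson pair $(\Lambda,\Lambda_1+a\Lambda(p))$ is generic and non-flat at $p$, where $\Lambda(p)$ is regarded as a constant bi-vector on $\mathcal A^*$. (ii) Therefore, given a non-unimodular Lie algebra $\tilde{\mathcal A}$ of odd dimension $\ge 5$, if there exist $\tilde\alpha,\tilde\beta\in\tilde{\mathcal A}^*$ such that $(d\tilde\alpha,d\tilde\beta)$ is generic, then on $\tilde{\mathcal A}^*$ there is a generic and non-flat linear Poisson pair.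
   Context: Lie algebras are finite-dimensional over $\mathbb K=\mathbb R$ or $\mathbb C$. A Lie algebra $\mathcal A$ is unimodular if $\mathrm{tr}[a,\cdot]=0$ for all $a\in\mathcal A$. For $\alpha\in\mathcal A^*$, $d\alpha\in\Lambda^2\mathcal A^*$ is $d\alpha(a,b)=-\alpha([a,b])$ (Chevalley–Eilenberg differential). Linear Poisson pair: a couple $(\Lambda,\Lambda_1)$ of bi-vectors on $\mathcal A^*$ where $\Lambda$ is the Lie–Poisson structure (elements of $\mathcal A$ being regarded as linear functions on $\mathcal A^*$, $\Lambda(a,b)=[a,b]$), and $\Lambda_1$ is the constant bi-vector on $\mathcal A^*$ given by some $\beta\in\Lambda^2\mathcal A^*$ with $d\beta=0$ (equivalently, $\Lambda_1$ is constant and $\Lambda+\Lambda_1$ is Poisson). A couple of bi-vectors on a $(2n-1)$-dimensional space is generic at a point $p$ if $(s\Lambda+t\Lambda_1)^{n-1}(p)\neq0$ for all $(s,t)\in\mathbb C^2\setminus\{0\}$ (complexifying in the real case). It is flat at $p$ if in some local coordinates around $p$ (smooth if $\mathbb K=\mathbb R$, holomorphic if $\mathbb K=\mathbb C$) both bi-vectors have constant coefficients. A linear Poisson pair is called generic if it is generic at some point, and flat if it is flat at every generic point. A couple $(\beta,\beta_1)$ of $2$-forms on a vector space of dimension $2n-1\ge3$ is generic if $(s\beta+t\beta_1)^{n-1}\ne0$ for all $(s,t)\in\mathbb C^2\setminus\{0\}$. *)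

theory Defs
  imports "HOL-Analysis.Analysis"
begin

text \<open>
  A Lie algebra \<open>\<A>\<close> of dimension \<open>CARD('m)\<close> over a field \<open>'k\<close> is given by its bracket in a basis,
  i.e. its carrier is \<open>'k ^ 'm\<close>. The dual \<open>\<A>*\<close> is \<open>'k ^ 'm\<close> in the dual basis, the pairing being
  \<^const>\<open>scalar_product\<close> (bilinear also over the complex numbers). Since the cotangent space of
  \<open>\<A>*\<close> at each point is \<open>\<A>\<close>, a bi-vector at a point of \<open>\<A>*\<close> is, like a 2-form on
  \<open>\<A>\<close>, an alternating bilinear form on \<open>'k ^ 'm\<close>.
\<close>

type_synonym ('k, 'm) form2 = "'k ^ 'm \<Rightarrow> 'k ^ 'm \<Rightarrow> 'k"
type_synonym ('k, 'm) bivector_field = "'k ^ 'm \<Rightarrow> ('k, 'm) form2"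


section \<open>Lie algebras\<close>

definition lie_algebra :: "('k::field ^ 'm::finite \<Rightarrow> 'k ^ 'm \<Rightarrow> 'k ^ 'm) \<Rightarrow> bool" where
  "lie_algebra br \<longleftrightarrow>
     (\<forall>a. Vector_Spaces.linear (*s) (*s) (\<lambda>b. br a b)) \<and>
     (\<forall>b. Vector_Spaces.linear (*s) (*s) (\<lambda>a. br a b)) \<and>
     (\<forall>a. br a a = 0) \<and>
     (\<forall>a b c. br a (br b c) + br b (br c a) + br c (br a b) = 0)"

definition unimodular :: "('k::field ^ 'm::finite \<Rightarrow> 'k ^ 'm \<Rightarrow> 'k ^ 'm) \<Rightarrow> bool" where
  "unimodular br \<longleftrightarrow> (\<forall>a. trace (matrix (br a)) = 0)"

definition alternating_form2 :: "('k::field, 'm::finite) form2 \<Rightarrow> bool" where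
  "alternating_form2 \<omega> \<longleftrightarrow>
     (\<forall>a. Vector_Spaces.linear (*s) (*) (\<lambda>b. \<omega> a b)) \<and>
     (\<forall>b. Vector_Spaces.linear (*s) (*) (\<lambda>a. \<omega> a b)) \<and>
     (\<forall>a. \<omega> a a = 0)"

text \<open>Chevalley--Eilenberg differentials of 1-forms and of 2-forms (trivial coefficients).\<close>

definition ce_d1 :: "('k::field ^ 'm::finite \<Rightarrow> 'k ^ 'm \<Rightarrow> 'k ^ 'm) \<Rightarrow> 'k ^ 'm \<Rightarrow> ('k, 'm) form2" where
  "ce_d1 br \<alpha> a b = - scalar_product \<alpha> (br a b)"

definition ce_d2 ::
  "('k::field ^ 'm::finite \<Rightarrow> 'k ^ 'm \<Rightarrow> 'k ^ 'm) \<Rightarrow> ('k, 'm) form2 \<Rightarrow> 'k ^ 'm \<Rightarrow> 'k ^ 'm \<Rightarrow> 'k ^ 'm \<Rightarrow> 'k"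
  where "ce_d2 br \<beta> a b c = - \<beta> (br a b) c + \<beta> (br a c) b - \<beta> (br b c) a"


section \<open>Linear Poisson pairs\<close>

definition lie_poisson :: "('k::field ^ 'm::finite \<Rightarrow> 'k ^ 'm \<Rightarrow> 'k ^ 'm) \<Rightarrow> ('k, 'm) bivector_field" where
  "lie_poisson br p a b = scalar_product p (br a b)"

definition linear_poisson_pair ::
  "('k::field ^ 'm::finite \<Rightarrow> 'k ^ 'm \<Rightarrow> 'k ^ 'm) \<Rightarrow>
   ('k, 'm) bivector_field \<Rightarrow> ('k, 'm) bivector_field \<Rightarrow> bool" where
  "linear_poisson_pair br \<Lambda> \<Lambda>1 \<longleftrightarrow>
     \<Lambda> = lie_poisson br \<and>
     (\<exists>\<beta>. alternating_form2 \<beta> \<and> (\<forall>a b c. ce_d2 br \<beta> a b c = 0) \<and> \<Lambda>1 = (\<lambda>_. \<beta>))"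


section \<open>Genericity\<close>

text \<open>
  A \<open>p\<close>-form takes a sequence of vectors, of which only the entries with index below \<open>p\<close> matter.
\<close>

definition wedge ::
  "nat \<Rightarrow> nat \<Rightarrow> ((nat \<Rightarrow> 'v) \<Rightarrow> 'c::field_char_0) \<Rightarrow> ((nat \<Rightarrow> 'v) \<Rightarrow> 'c) \<Rightarrow> (nat \<Rightarrow> 'v) \<Rightarrow> 'c" where
  "wedge p q \<alpha> \<beta> v =
     1 / (fact p * fact q) *
     (\<Sum>\<sigma> | \<sigma> permutes {..<p + q}.
        of_int (sign \<sigma>) * \<alpha> (\<lambda>i. v (\<sigma> i)) * \<beta> (\<lambda>i. v (\<sigma> (p + i))))"

primrec wedge_power2 :: "('v \<Rightarrow> 'v \<Rightarrow> 'c::field_char_0) \<Rightarrow> nat \<Rightarrow> (nat \<Rightarrow> 'v) \<Rightarrow> 'c" where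
  "wedge_power2 \<omega> 0 = (\<lambda>_. 1)"
| "wedge_power2 \<omega> (Suc k) = wedge 2 (2 * k) (\<lambda>v. \<omega> (v 0) (v 1)) (wedge_power2 \<omega> k)"

text \<open>
  The argument \<open>\<iota>\<close> embeds the scalars into the complex numbers: \<^const>\<open>of_real\<close> over the reals and
  the identity over the complex numbers. In the real case, elements of the complexified exterior
  power are complex-valued real-multilinear alternating forms. In dimension \<open>CARD('m) = 2 n - 1\<close>
  the exponent is \<open>n - 1\<close>.
\<close>

definition generic_couple ::
  "('k \<Rightarrow> complex) \<Rightarrow> ('k, 'm::finite) form2 \<Rightarrow> ('k, 'm) form2 \<Rightarrow> bool" where
  "generic_couple \<iota> \<omega> \<omega>1 \<longleftrightarrow>
     (\<forall>s t. (s, t) \<noteq> (0, 0) \<longrightarrow>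
        wedge_power2 (\<lambda>a b. s * \<iota> (\<omega> a b) + t * \<iota> (\<omega>1 a b)) ((CARD('m) - 1) div 2) \<noteq> (\<lambda>_. 0))"

definition generic_at ::
  "('k \<Rightarrow> complex) \<Rightarrow> ('k, 'm::finite) bivector_field \<Rightarrow> ('k, 'm) bivector_field \<Rightarrow> 'k ^ 'm \<Rightarrow> bool"
  where "generic_at \<iota> \<Lambda> \<Lambda>1 p \<longleftrightarrow> generic_couple \<iota> (\<Lambda> p) (\<Lambda>1 p)"

definition generic_pair ::
  "('k \<Rightarrow> complex) \<Rightarrow> ('k, 'm::finite) bivector_field \<Rightarrow> ('k, 'm) bivector_field \<Rightarrow> bool" where
  "generic_pair \<iota> \<Lambda> \<Lambda>1 \<longleftrightarrow> (\<exists>p. generic_at \<iota> \<Lambda> \<Lambda>1 p)"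


section \<open>Local coordinates and flatness\<close>

primrec Ck_on :: "nat \<Rightarrow> (real ^ 'm::finite) set \<Rightarrow> (real ^ 'm \<Rightarrow> real) \<Rightarrow> bool" where
  "Ck_on 0 U f \<longleftrightarrow> continuous_on U f"
| "Ck_on (Suc k) U f \<longleftrightarrow>
     (\<exists>D. (\<forall>x\<in>U. (f has_derivative (\<lambda>h. \<Sum>i\<in>UNIV. D i x * h $ i)) (at x)) \<and>
          (\<forall>i. Ck_on k U (D i)))"

definition smooth_fun_on :: "(real ^ 'm::finite) set \<Rightarrow> (real ^ 'm \<Rightarrow> real) \<Rightarrow> bool" where
  "smooth_fun_on U f \<longleftrightarrow> (\<forall>k. Ck_on k U f)"

definition holomorphic_fun_on :: "(complex ^ 'm::finite) set \<Rightarrow> (complex ^ 'm \<Rightarrow> complex) \<Rightarrow> bool" where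
  "holomorphic_fun_on U f \<longleftrightarrow>
     (\<forall>x\<in>U. \<exists>d. (f has_derivative (\<lambda>h. \<Sum>i\<in>UNIV. d i * h $ i)) (at x))"

text \<open>
  In what follows \<open>reg U f\<close> says that the scalar function \<open>f\<close> is regular on the open set \<open>U\<close>; it is
  \<^const>\<open>smooth_fun_on\<close> over the reals and \<^const>\<open>holomorphic_fun_on\<close> over the complex numbers.
\<close>

definition local_coordinates ::
  "(('k::real_normed_field ^ 'm::finite) set \<Rightarrow> ('k ^ 'm \<Rightarrow> 'k) \<Rightarrow> bool) \<Rightarrow>
   'k ^ 'm \<Rightarrow> ('k ^ 'm) set \<Rightarrow> ('k ^ 'm \<Rightarrow> 'k ^ 'm) \<Rightarrow> bool" where
  "local_coordinates reg p U \<phi> \<longleftrightarrow>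
     open U \<and> p \<in> U \<and> open (\<phi> ` U) \<and>
     (\<forall>i. reg U (\<lambda>x. \<phi> x $ i)) \<and>
     (\<exists>\<psi>. (\<forall>x\<in>U. \<psi> (\<phi> x) = x) \<and> (\<forall>i. reg (\<phi> ` U) (\<lambda>y. \<psi> y $ i)))"

text \<open>The differential of a function on \<open>\<A>*\<close> at a point, as an element of the cotangent space \<open>\<A>\<close>.\<close>

definition differential ::
  "('k::real_normed_field ^ 'm::finite \<Rightarrow> 'k) \<Rightarrow> 'k ^ 'm \<Rightarrow> 'k ^ 'm" where
  "differential f x = (\<chi> j. frechet_derivative f (at x) (axis j 1))"

definition constant_coefficients ::
  "('k::real_normed_field ^ 'm::finite) set \<Rightarrow> ('k ^ 'm \<Rightarrow> 'k ^ 'm) \<Rightarrow>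
   ('k, 'm) bivector_field \<Rightarrow> bool" where
  "constant_coefficients U \<phi> \<Lambda> \<longleftrightarrow>
     (\<exists>C. \<forall>x\<in>U. \<forall>i j.
        \<Lambda> x (differential (\<lambda>z. \<phi> z $ i) x) (differential (\<lambda>z. \<phi> z $ j) x) = C i j)"

definition flat_at ::
  "(('k::real_normed_field ^ 'm::finite) set \<Rightarrow> ('k ^ 'm \<Rightarrow> 'k) \<Rightarrow> bool) \<Rightarrow>
   ('k, 'm) bivector_field \<Rightarrow> ('k, 'm) bivector_field \<Rightarrow> 'k ^ 'm \<Rightarrow> bool" where
  "flat_at reg \<Lambda> \<Lambda>1 p \<longleftrightarrow>
     (\<exists>U \<phi>. local_coordinates reg p U \<phi> \<and>
            constant_coefficients U \<phi> \<Lambda> \<and> constant_coefficients U \<phi> \<Lambda>1)"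

definition flat_pair ::
  "('k \<Rightarrow> complex) \<Rightarrow> (('k::real_normed_field ^ 'm::finite) set \<Rightarrow> ('k ^ 'm \<Rightarrow> 'k) \<Rightarrow> bool) \<Rightarrow>
   ('k, 'm) bivector_field \<Rightarrow> ('k, 'm) bivector_field \<Rightarrow> bool" where
  "flat_pair \<iota> reg \<Lambda> \<Lambda>1 \<longleftrightarrow> (\<forall>p. generic_at \<iota> \<Lambda> \<Lambda>1 p \<longrightarrow> flat_at reg \<Lambda> \<Lambda>1 p)"

end

theory Submission
  imports Defs
    "HOL-Complex_Analysis.Cauchy_Integral_Formula"
    "HOL-Computational_Algebra.Fundamental_Theorem_Algebra"
begin

text \<open>
  The obstruction to flatness is the modular vector field. If both bi-vectors have constant
  coefficients in some coordinates, the coordinate volume makes both of them divergence free.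
  Comparing that volume with the translation invariant volume of \<open>\<A>*\<close>, for which \<open>\<Lambda>1\<close> has divergence
  \<open>0\<close> and \<open>\<Lambda>\<close> has the constant divergence \<open>b \<mapsto> - tr (ad b)\<close>, the logarithmic differential \<open>v \<in> \<A>\<close> of
  the ratio of the two volumes at \<open>p\<close> satisfies

    \<open>\<Lambda>1(v, b) = 0\<close> and \<open>\<Lambda>(p)(v, b) = - tr (ad b)\<close> for all \<open>b\<close>

  (lemma \<open>flat_modular_covector\<close>). Suppose that \<open>(\<Lambda>, \<Lambda>1)\<close> and \<open>(\<Lambda>, \<Lambda>1 + a \<Lambda>(p))\<close> are both flat at \<open>p\<close>, and
  let \<open>v\<close> and \<open>w\<close> be the two resulting vectors. Write \<open>A\<close> for \<open>\<Lambda>1\<close>, \<open>B\<close> for \<open>\<Lambda>(p)\<close> and \<open>\<chi>\<close> for \<open>- tr \<circ> ad\<close>.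
  Then \<open>A v = 0\<close>, \<open>B v = B w = \<chi>\<close> and \<open>A w = - a \<chi>\<close>, where \<open>\<chi> \<noteq> 0\<close> since \<open>\<A>\<close> is not unimodular. So \<open>v\<close>,
  \<open>v - w\<close> and \<open>w\<close> lie in the kernels of the three different members \<open>A\<close>, \<open>B\<close> and \<open>A + a B\<close> of the
  pencil, but they span only a plane. In a generic pencil on a space of dimension \<open>2 n - 1\<close> the
  kernels form a rational curve of degree \<open>n - 1\<close>, and any \<open>n\<close> of its points are independent; for
  \<open>n \<ge> 3\<close> this is a contradiction. Lemma \<open>no_kernel_line_of_degree_one\<close> gives a direct argument:
  modulo the plane, inside the hyperplane \<open>\<chi> = 0\<close>, the pencil is a nonempty pencil of square matrices,
  so over the complex numbers one of its members degenerates, and then the corresponding member of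
  the original pencil has a kernel of dimension at least two. Genericity excludes this, because the
  top power of a 2-form whose kernel has dimension two vanishes
  (\<open>wedge_power2_eq_0_if_degenerate\<close>).

  The second claim follows by evaluating at the point where \<open>\<Lambda>\<close> equals \<open>d\<alpha>\<close> and taking \<open>d\<beta>\<close> as
  \<open>\<Lambda>1\<close>: that pair is generic, and if it happens to be flat there, the first claim perturbs it into
  a non-flat one.

  The divergence computation needs two derivatives of the inverse coordinate change. Over the
  complex numbers only one is given, and the second comes from the Cauchy integral formula
  (\<open>partial_derivatives_holomorphic\<close>). The rest is done over both fields at once; an embedding
  \<open>\<iota>\<close> of the scalars into the complex numbers complexifies forms where eigenvalues are needed.
\<close>

section \<open>Powers of a 2-form and its kernel\<close>

text \<open>
  A form takes a whole sequence of vectors, so multilinearity includes that only the first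
  \<open>n\<close> of them matter. Linearity in one equation keeps the permutation argument for wedge
  products short.
\<close>

definition multilinear_form :: "nat \<Rightarrow> ((nat \<Rightarrow> 'c::field_char_0 ^ 'm::finite) \<Rightarrow> 'c) \<Rightarrow> bool" where
  "multilinear_form n F \<longleftrightarrow>
     (\<forall>v w. (\<forall>i<n. v i = w i) \<longrightarrow> F v = F w) \<and>
     (\<forall>v j x y c. j < n \<longrightarrow> F (v(j := c *s x + y)) = c * F (v(j := x)) + F (v(j := y)))"

lemma multilinear_formD:
  assumes "multilinear_form n F"
  shows "(\<And>i. i < n \<Longrightarrow> v i = w i) \<Longrightarrow> F v = F w"
    and "j < n \<Longrightarrow> F (v(j := c *s x + y)) = c * F (v(j := x)) + F (v(j := y))"
  using assms unfolding multilinear_form_def by blast+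

text \<open>
  In every summand the argument number \<open>j\<close> is fed into exactly one of the two factors, into
  its slot \<open>\<sigma>\<inverse> j\<close> or \<open>\<sigma>\<inverse> j - p\<close>.
\<close>

lemma multilinear_form_wedge:
  assumes \<alpha>: "multilinear_form p \<alpha>" and \<beta>: "multilinear_form q \<beta>"
  shows "multilinear_form (p + q) (wedge p q \<alpha> \<beta>)"
  unfolding multilinear_form_def
proof (intro conjI allI impI)
  fix v w :: "nat \<Rightarrow> 'a ^ 'b"
  assume vw: "\<forall>i<p + q. v i = w i"
  show "wedge p q \<alpha> \<beta> v = wedge p q \<alpha> \<beta> w"
    unfolding wedge_def
  proof (rule arg_cong2[where f="(*)"], rule refl, rule sum.cong, rule refl, clarify)
    fix \<sigma> assume "\<sigma> permutes {..<p + q}"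
    then have s: "\<sigma> i < p + q" if "i < p + q" for i
      using permutes_in_image[of \<sigma> "{..<p + q}" i] that by auto
    have "\<alpha> (\<lambda>i. v (\<sigma> i)) = \<alpha> (\<lambda>i. w (\<sigma> i))"
      by (rule multilinear_formD(1)[OF \<alpha>]) (simp add: vw s)
    moreover have "\<beta> (\<lambda>i. v (\<sigma> (p + i))) = \<beta> (\<lambda>i. w (\<sigma> (p + i)))"
      by (rule multilinear_formD(1)[OF \<beta>]) (simp add: vw s)
    ultimately show "of_int (sign \<sigma>) * \<alpha> (\<lambda>i. v (\<sigma> i)) * \<beta> (\<lambda>i. v (\<sigma> (p + i))) =
      of_int (sign \<sigma>) * \<alpha> (\<lambda>i. w (\<sigma> i)) * \<beta> (\<lambda>i. w (\<sigma> (p + i)))" by simp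
  qed
next
  fix v :: "nat \<Rightarrow> 'a ^ 'b" and j x y c
  assume j: "j < p + q"
  define t where "t \<sigma> u = of_int (sign \<sigma>) * \<alpha> (\<lambda>i. u (\<sigma> i)) * \<beta> (\<lambda>i. u (\<sigma> (p + i)))"
    for \<sigma> and u :: "nat \<Rightarrow> 'a ^ 'b"
  have t: "t \<sigma> (v(j := c *s x + y)) = c * t \<sigma> (v(j := x)) + t \<sigma> (v(j := y))"
    if \<sigma>: "\<sigma> permutes {..<p + q}" for \<sigma>
  proof -
    define k where "k = inv \<sigma> j"
    have sk: "\<sigma> i = j \<longleftrightarrow> i = k" for i
      unfolding k_def using permutes_inverses[OF \<sigma>] by metis
    have "k < p + q"
      using permutes_in_image[OF \<sigma>, of k] j sk[of k] by (simp add: lessThan_iff)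
    then consider "k < p" | k' where "k = p + k'" "k' < q"
      by (metis add_less_cancel_left le_Suc_ex not_le)
    then show ?thesis
    proof cases
      case 1
      have "(\<lambda>i. (v(j := z)) (\<sigma> i)) = (\<lambda>i. v (\<sigma> i))(k := z)" for z
        using sk by auto
      moreover have "(\<lambda>i. (v(j := z)) (\<sigma> (p + i))) = (\<lambda>i. v (\<sigma> (p + i)))" for z
        using sk 1 by auto
      ultimately show ?thesis
        unfolding t_def by (simp only: multilinear_formD(2)[OF \<alpha> 1]) (simp add: algebra_simps)
    next
      case 2
      have "\<alpha> (\<lambda>i. (v(j := z)) (\<sigma> i)) = \<alpha> (\<lambda>i. v (\<sigma> i))" for z
        by (rule multilinear_formD(1)[OF \<alpha>]) (use sk 2 in auto)
      moreover have "(\<lambda>i. (v(j := z)) (\<sigma> (p + i))) = (\<lambda>i. v (\<sigma> (p + i)))(k' := z)" for z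
        using sk 2 by auto
      ultimately show ?thesis
        unfolding t_def by (simp only: multilinear_formD(2)[OF \<beta> 2(2)]) (simp add: algebra_simps)
    qed
  qed
  have "(\<Sum>\<sigma> | \<sigma> permutes {..<p + q}. t \<sigma> (v(j := c *s x + y))) =
      (\<Sum>\<sigma> | \<sigma> permutes {..<p + q}. c * t \<sigma> (v(j := x)) + t \<sigma> (v(j := y)))"
    by (rule sum.cong) (auto simp: t)
  then show "wedge p q \<alpha> \<beta> (v(j := c *s x + y)) =
      c * wedge p q \<alpha> \<beta> (v(j := x)) + wedge p q \<alpha> \<beta> (v(j := y))"
    unfolding wedge_def t_def[symmetric]
    by (simp add: sum.distrib sum_distrib_left[symmetric] algebra_simps add_divide_distrib)
qed

text \<open>
  In each summand the argument \<open>z\<close> lands in one of the two factors. This carries the kernel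
  of a 2-form over to its powers.
\<close>

lemma wedge_eq_0_if_vanishing:
  assumes \<alpha>: "\<And>v i. i < p \<Longrightarrow> v i = z \<Longrightarrow> \<alpha> v = 0"
    and \<beta>: "\<And>v i. i < q \<Longrightarrow> v i = z \<Longrightarrow> \<beta> v = 0"
    and j: "j < p + q" "v j = z"
  shows "wedge p q \<alpha> \<beta> v = 0"
proof -
  have "of_int (sign \<sigma>) * \<alpha> (\<lambda>i. v (\<sigma> i)) * \<beta> (\<lambda>i. v (\<sigma> (p + i))) = 0"
    if \<sigma>: "\<sigma> permutes {..<p + q}" for \<sigma>
  proof -
    obtain k where k: "\<sigma> k = j"
      using permutes_inverses(1)[OF \<sigma>] by metis
    then have "k < p + q"
      using permutes_in_image[OF \<sigma>, of k] j by auto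
    then consider "k < p" | k' where "k = p + k'" "k' < q"
      by (metis add_less_cancel_left le_Suc_ex not_le)
    then show ?thesis
      by cases (use \<alpha>[of _ "\<lambda>i. v (\<sigma> i)"] \<beta>[of _ "\<lambda>i. v (\<sigma> (p + i))"] j k in auto)
  qed
  then show ?thesis
    unfolding wedge_def by (simp add: sum.neutral)
qed

text \<open>
  Reindexing the sum by \<open>\<sigma> \<mapsto> \<tau> \<circ> \<sigma>\<close>. So the antisymmetry of a wedge product comes from the
  sum over all permutations alone.
\<close>

lemma wedge_permute:
  fixes \<alpha> \<beta> :: "(nat \<Rightarrow> 'v) \<Rightarrow> 'c::field_char_0"
  assumes \<tau>: "\<tau> permutes {..<p + q}"
  shows "wedge p q \<alpha> \<beta> (v \<circ> \<tau>) = of_int (sign \<tau>) * wedge p q \<alpha> \<beta> v"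
proof -
  let ?P = "{\<sigma>. \<sigma> permutes {..<p + q}}"
  define t where "t \<sigma> = of_int (sign \<sigma>) * \<alpha> (\<lambda>i. v (\<sigma> i)) * \<beta> (\<lambda>i. v (\<sigma> (p + i)))" for \<sigma>
  have "of_int (sign \<sigma>) * \<alpha> (\<lambda>i. (v \<circ> \<tau>) (\<sigma> i)) * \<beta> (\<lambda>i. (v \<circ> \<tau>) (\<sigma> (p + i)))
      = of_int (sign \<tau>) * t (\<tau> \<circ> \<sigma>)" if "\<sigma> \<in> ?P" for \<sigma>
  proof -
    have "permutation \<sigma>" "permutation \<tau>"
      using that \<tau> permutation_permutes by blast+
    then have "of_int (sign \<tau>) * (of_int (sign (\<tau> \<circ> \<sigma>)) :: 'c) = of_int (sign \<sigma>)"
      by (simp add: sign_compose of_int_mult[symmetric] mult.assoc[symmetric] del: of_int_mult)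
    then show ?thesis
      unfolding t_def by (simp add: mult.assoc[symmetric])
  qed
  then have "(\<Sum>\<sigma>\<in>?P. of_int (sign \<sigma>) * \<alpha> (\<lambda>i. (v \<circ> \<tau>) (\<sigma> i)) * \<beta> (\<lambda>i. (v \<circ> \<tau>) (\<sigma> (p + i))))
      = (\<Sum>\<sigma>\<in>?P. of_int (sign \<tau>) * t (\<tau> \<circ> \<sigma>))"
    by (rule sum.cong[OF refl])
  also have "\<dots> = of_int (sign \<tau>) * (\<Sum>\<sigma>\<in>?P. t \<sigma>)"
    unfolding sum_distrib_left[symmetric]
    using setum_permutations_compose_left[OF \<tau>, of t] by simp
  finally show ?thesis
    unfolding wedge_def t_def by simp
qed

lemma wedge_eq_0_if_repeated:
  assumes "i < p + q" "j < p + q" "i \<noteq> j" "v i = v j"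
  shows "wedge p q \<alpha> \<beta> v = 0"
proof -
  have "v \<circ> Transposition.transpose i j = v"
    using assms(4) by (auto simp: fun_eq_iff Transposition.transpose_def)
  moreover have "Transposition.transpose i j permutes {..<p + q}"
    using assms by (simp add: permutes_swap_id)
  ultimately have "wedge p q \<alpha> \<beta> v = - wedge p q \<alpha> \<beta> v"
    using wedge_permute[of "Transposition.transpose i j" p q \<alpha> \<beta> v] assms(3) by (simp add: sign_swap_id)
  then show ?thesis by simp
qed

text \<open>
  Linear dependence for a family, so that repeated vectors need no separate treatment later.
\<close>

lemma nontrivial_relation:
  fixes u :: "'i \<Rightarrow> 'c::field ^ 'm::finite"
  assumes I: "finite I" and card: "card I > CARD('m)"
  shows "\<exists>c. (\<exists>i\<in>I. c i \<noteq> 0) \<and> (\<Sum>i\<in>I. c i *s u i) = 0"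
proof (cases "inj_on u I")
  case True
  have "card (u ` I) > vec.dim (UNIV :: ('c ^ 'm) set)"
    using card by (simp add: card_image[OF True] vec.dim_UNIV card_cart_basis)
  then have "vec.dependent (u ` I)"
    using vec.independent_card_le_dim[of "u ` I" UNIV] by fastforce
  then obtain f where f: "\<exists>x\<in>u ` I. f x \<noteq> 0" "(\<Sum>x\<in>u ` I. f x *s x) = 0"
    using vec.dependent_finite[of "u ` I"] I by auto
  then show ?thesis
    by (intro exI[of _ "f \<circ> u"]) (auto simp: sum.reindex[OF True])
next
  case False
  then obtain i j where ij: "i \<in> I" "j \<in> I" "i \<noteq> j" "u i = u j"
    by (auto simp: inj_on_def)
  define c where "c k = (if k = i then 1 else if k = j then - 1 else 0 :: 'c)" for k
  have "(\<Sum>k\<in>I. c k *s u k) = (\<Sum>k\<in>{i, j}. c k *s u k)"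
    by (rule sum.mono_neutral_right) (use I ij in \<open>auto simp: c_def\<close>)
  also have "\<dots> = 0"
    using ij by (simp add: c_def)
  finally show ?thesis
    using ij(1) by (intro exI[of _ c]) (auto simp: c_def)
qed

lemma alternating_form2D:
  assumes "alternating_form2 \<omega>"
  shows "\<omega> (x + y) z = \<omega> x z + \<omega> y z" "\<omega> (c *s x) z = c * \<omega> x z"
    "\<omega> z (x + y) = \<omega> z x + \<omega> z y" "\<omega> z (c *s x) = c * \<omega> z x"
    "\<omega> x x = 0" "\<omega> 0 z = 0" "\<omega> z 0 = 0"
    "\<omega> (x - y) z = \<omega> x z - \<omega> y z" "\<omega> z (x - y) = \<omega> z x - \<omega> z y"
proof -
  interpret l: Vector_Spaces.linear "(*s)" "(*)" "\<lambda>a. \<omega> a z"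
    using assms by (simp add: alternating_form2_def)
  interpret r: Vector_Spaces.linear "(*s)" "(*)" "\<lambda>a. \<omega> z a"
    using assms by (simp add: alternating_form2_def)
  show "\<omega> (x + y) z = \<omega> x z + \<omega> y z" "\<omega> (c *s x) z = c * \<omega> x z"
    "\<omega> z (x + y) = \<omega> z x + \<omega> z y" "\<omega> z (c *s x) = c * \<omega> z x"
    "\<omega> x x = 0" "\<omega> 0 z = 0" "\<omega> z 0 = 0"
    "\<omega> (x - y) z = \<omega> x z - \<omega> y z" "\<omega> z (x - y) = \<omega> z x - \<omega> z y"
    using assms by (simp_all add: alternating_form2_def l.add l.scale r.add r.scale l.zero r.zero
      l.diff r.diff)
qed

lemma alternating_form2_commute:
  assumes "alternating_form2 \<omega>"
  shows "\<omega> x y = - \<omega> y x"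
proof -
  have "\<omega> (x + y) (x + y) = \<omega> x x + \<omega> y x + (\<omega> x y + \<omega> y y)"
    by (simp only: alternating_form2D(1,3)[OF assms])
  then have "\<omega> x y + \<omega> y x = 0"
    by (simp add: alternating_form2D(5)[OF assms] add.commute)
  then show ?thesis
    by (rule eq_neg_iff_add_eq_0[THEN iffD2])
qed

lemma alternating_form2_sum:
  assumes "alternating_form2 \<omega>"
  shows "\<omega> (\<Sum>i\<in>I. c i *s x i) z = (\<Sum>i\<in>I. c i * \<omega> (x i) z)"
    "\<omega> z (\<Sum>i\<in>I. c i *s x i) = (\<Sum>i\<in>I. c i * \<omega> z (x i))"
proof -
  show "\<omega> (\<Sum>i\<in>I. c i *s x i) z = (\<Sum>i\<in>I. c i * \<omega> (x i) z)"
    by (induction I rule: infinite_finite_induct) (auto simp: alternating_form2D[OF assms])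
  show "\<omega> z (\<Sum>i\<in>I. c i *s x i) = (\<Sum>i\<in>I. c i * \<omega> z (x i))"
    by (induction I rule: infinite_finite_induct) (auto simp: alternating_form2D[OF assms])
qed

lemma multilinear_form_wedge_power2:
  assumes \<omega>: "alternating_form2 \<omega>"
  shows "multilinear_form (2 * k) (wedge_power2 \<omega> k)"
proof (induction k)
  case 0
  show ?case by (simp add: multilinear_form_def)
next
  case (Suc k)
  have "multilinear_form 2 (\<lambda>v. \<omega> (v 0) (v 1))"
    unfolding multilinear_form_def
    by (auto simp: alternating_form2D[OF \<omega>] less_2_cases_iff)
  from multilinear_form_wedge[OF this Suc] show ?case by simp
qed

lemma wedge_power2_eq_0_if_kernel:
  assumes \<omega>: "alternating_form2 \<omega>" and z: "\<And>y. \<omega> z y = 0"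
    and "j < 2 * k" "v j = z"
  shows "wedge_power2 \<omega> k v = 0"
  using assms(3,4)
proof (induction k arbitrary: v j)
  case (Suc k)
  show ?case
    unfolding wedge_power2.simps
  proof (rule wedge_eq_0_if_vanishing[where z=z and j=j])
    show "\<omega> (u 0) (u 1) = 0" if "i < 2" "u i = z" for u and i :: nat
      using that z alternating_form2_commute[OF \<omega>, of _ z] by (auto simp: less_2_cases_iff)
  qed (use Suc in auto)
qed auto

text \<open>
  A \<open>2 k\<close>-form that is alternating and vanishes on the kernel of \<open>\<omega>\<close> descends to the
  quotient by that kernel. If \<open>x\<close> and \<open>x'\<close> are independent elements of the kernel, the
  quotient has dimension less than \<open>2 k\<close>. Concretely, \<open>2 k\<close> arguments have a nontrivial
  combination lying in the kernel, and one of them can be replaced by that combination.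
\<close>

lemma wedge_power2_eq_0_if_degenerate:
  fixes \<omega> :: "('c::field_char_0, 'm::finite) form2"
  assumes \<omega>: "alternating_form2 \<omega>"
    and k: "0 < k" "CARD('m) < 2 * k + 2"
    and x: "\<And>y. \<omega> x y = 0" "x \<noteq> 0"
    and x': "\<And>y. \<omega> x' y = 0" "\<And>c. x' \<noteq> c *s x"
  shows "wedge_power2 \<omega> k v = 0"
proof -
  let ?F = "wedge_power2 \<omega> k"
  define u where "u i = (if i < 2 * k then v i else if i = 2 * k then x else x')" for i
  obtain c where c: "\<exists>i\<in>{..<2 * k + 2}. c i \<noteq> 0" "(\<Sum>i<2 * k + 2. c i *s u i) = 0"
    using nontrivial_relation[of "{..<2 * k + 2}" u] k by auto
  define n where "n = (\<Sum>i<2 * k. c i *s v i)"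
  have "(\<Sum>i<2 * k + 2. c i *s u i) = n + c (2 * k) *s x + c (Suc (2 * k)) *s x'"
    by (simp add: n_def u_def)
  with c have n: "n + c (2 * k) *s x + c (Suc (2 * k)) *s x' = 0" by simp
  obtain j where j: "j < 2 * k" "c j \<noteq> 0"
  proof (rule ccontr)
    assume no: "\<not> thesis"
    note jI = that
    have 0: "c i = 0" if "i < 2 * k" for i
      using no that jI by metis
    with c have "c (2 * k) \<noteq> 0 \<or> c (Suc (2 * k)) \<noteq> 0"
      by (auto simp: less_Suc_eq)
    moreover have e: "c (2 * k) *s x + c (Suc (2 * k)) *s x' = 0"
      using n 0 by (simp add: n_def)
    ultimately have "c (Suc (2 * k)) \<noteq> 0"
      using x(2) by auto
    then have "x' = (- c (2 * k) / c (Suc (2 * k))) *s x"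
      using e by (simp add: vec_eq_iff field_simps add_eq_0_iff)
    with x'(2) show False by blast
  qed
  \<comment> \<open>Substituting the kernel vector \<open>n\<close> for argument \<open>j\<close> gives \<open>0\<close>, and also \<open>c j\<close> times the original value.\<close>
  define G where "G y = ?F (v(j := y))" for y
  note ml = multilinear_form_wedge_power2[OF \<omega>, of k]
  have G: "G (a *s y + y') = a * G y + G y'" for a y y'
    unfolding G_def by (rule multilinear_formD(2)[OF ml j(1)])
  have G0: "G 0 = 0" using G[of 1 0 0] by simp
  have Gsum: "G (\<Sum>i\<in>I. c i *s v i) = (\<Sum>i\<in>I. c i * G (v i))" for I
    by (induction I rule: infinite_finite_induct) (auto simp: G G0)
  have "\<omega> n y = 0" for y
  proof -
    have "\<omega> (n + c (2 * k) *s x + c (Suc (2 * k)) *s x') y = 0"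
      by (simp add: n alternating_form2D[OF \<omega>])
    then show ?thesis by (simp add: alternating_form2D[OF \<omega>] x x')
  qed
  then have "G n = 0"
    unfolding G_def by (rule wedge_power2_eq_0_if_kernel[OF \<omega> _ j(1)]) simp
  moreover have "G (v i) = 0" if "i < 2 * k" "i \<noteq> j" for i
  proof -
    obtain k' where k': "k = Suc k'" using k by (cases k) auto
    have "wedge_power2 \<omega> k w = 0" if "w i = w j" for w
      unfolding k' wedge_power2.simps
      by (rule wedge_eq_0_if_repeated[of i _ _ j]) (use that \<open>i \<noteq> j\<close> \<open>i < 2 * k\<close> j k' in auto)
    then show ?thesis unfolding G_def using that by simp
  qed
  then have "(\<Sum>i<2 * k. c i * G (v i)) = (\<Sum>i\<in>{j}. c i * G (v i))"
    by (intro sum.mono_neutral_right) (use j in auto)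
  ultimately have "c j * G (v j) = 0"
    using Gsum[of "{..<2 * k}"] by (simp add: n_def)
  then show ?thesis using j by (simp add: G_def)
qed

text \<open>
  Powers are natural under arbitrary maps of the arguments. This moves a complex-valued form
  on real vectors to the complexified space.
\<close>

lemma wedge_power2_pullback:
  "wedge_power2 (\<lambda>a b. \<Omega> (f a) (f b)) k v = wedge_power2 \<Omega> k (f \<circ> v)"
  by (induction k arbitrary: v) (simp_all add: wedge_def o_def)

section \<open>Pencils of alternating forms\<close>

text \<open>
  An eigenvector on the quotient \<open>W / V\<close>. Some nonzero polynomial in \<open>T\<close> annihilates \<open>y\<close>.
  Splitting off linear factors one by one, the first vector that falls into \<open>V\<close> comes from
  an eigenvector modulo \<open>V\<close>.
\<close>

lemma eigenvector_modulo_subspace: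
  fixes T :: "complex ^ 'm \<Rightarrow> complex ^ 'm"
  assumes T: "Vector_Spaces.linear (*s) (*s) T"
    and W: "vec.subspace W" "\<And>u. u \<in> W \<Longrightarrow> T u \<in> W"
    and V: "vec.subspace V"
    and y: "y \<in> W" "y \<notin> V"
  obtains u c where "u \<in> W" "u \<notin> V" "T u - c *s u \<in> V"
proof -
  interpret T: Vector_Spaces.linear "(*s)" "(*s)" T by (rule T)
  have pow: "(T ^^ i) (a *s u + v) = a *s (T ^^ i) u + (T ^^ i) v" for i a u v
    by (induction i) (simp_all add: T.add T.scale)
  define act where "act p u = (\<Sum>i\<le>degree p. coeff p i *s (T ^^ i) u)" for p and u :: "complex ^ 'm"
  have act_ext: "act p u = (\<Sum>i\<le>N. coeff p i *s (T ^^ i) u)" if "degree p \<le> N" for p u N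
    unfolding act_def
    by (rule sum.mono_neutral_left) (use that in \<open>auto simp: coeff_eq_0\<close>)
  have act_pCons: "act (pCons a p) u = a *s u + act p (T u)" for a p u
  proof -
    have "act (pCons a p) u = (\<Sum>i\<le>Suc (degree p). coeff (pCons a p) i *s (T ^^ i) u)"
      by (rule act_ext) (simp add: degree_pCons_le)
    also have "\<dots> = a *s u + act p (T u)"
      unfolding act_def by (simp only: sum.atMost_Suc_shift) (simp add: funpow_swap1)
    finally show ?thesis .
  qed
  have act_lin: "act p (a *s u + v) = a *s act p u + act p v" for p a u v
    unfolding act_def by (simp add: pow vec.scale_right_distrib sum.distrib vec.scale_sum_right mult.commute)
  have act_mult: "act ([:- c, 1:] * q) u = act q (T u - c *s u)" for c q u
  proof -
    have add: "act (p + r) u = act p u + act r u" for p r u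
      using act_ext[of p "max (degree p) (degree r)" u] act_ext[of r "max (degree p) (degree r)" u]
        act_ext[of "p + r" "max (degree p) (degree r)" u]
      by (simp add: degree_add_le_max vec.scale_left_distrib sum.distrib)
    have smult: "act (smult a p) u = a *s act p u" for a p u
      using act_ext[of "smult a p" "degree p" u]
      by (simp add: degree_smult_le act_def vec.scale_sum_right)
    have "[:- c, 1:] * q = smult (- c) q + pCons 0 q"
      by simp
    then have "act ([:- c, 1:] * q) u = (- c) *s act q u + act q (T u)"
      by (simp only: add smult act_pCons) simp
    also have "\<dots> = act q ((- c) *s u + T u)"
      by (simp only: act_lin)
    finally show ?thesis by (simp add: vec.scale_minus_left)
  qed
  have main: "\<exists>u c. u \<in> W \<and> u \<notin> V \<and> T u - c *s u \<in> V"
    if "p \<noteq> 0" "y \<in> W" "y \<notin> V" "act p y \<in> V" for p y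
    using that
  proof (induction "degree p" arbitrary: p y)
    case 0
    then obtain a where "p = [:a:]" "a \<noteq> 0"
      by (metis degree_eq_zeroE pCons_0_0)
    with 0 have "a *s y \<in> V" by (simp add: act_def)
    then have "(1 / a) *s (a *s y) \<in> V" by (rule vec.subspace_scale[OF V])
    with \<open>a \<noteq> 0\<close> 0 show ?case by simp
  next
    case (Suc d)
    have "\<not> constant (poly p)"
      using Suc.hyps(2) by (simp add: constant_degree)
    then obtain c where "poly p c = 0"
      using Fundamental_Theorem_Algebra.fundamental_theorem_of_algebra by blast
    then obtain q where q: "p = [:- c, 1:] * q"
      by (auto simp: poly_eq_0_iff_dvd)
    have "q \<noteq> 0" using Suc.prems q by auto
    then have "degree q = d"
      using Suc.hyps(2) q degree_mult_eq[of "[:- c, 1:]" q] by simp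
    show ?case
    proof (cases "T y - c *s y \<in> V")
      case True
      then show ?thesis using Suc.prems by blast
    next
      case False
      moreover have "T y - c *s y \<in> W"
        using W Suc.prems by (intro vec.subspace_diff vec.subspace_scale) auto
      moreover have "act q (T y - c *s y) \<in> V"
        using Suc.prems q act_mult by simp
      ultimately show ?thesis
        using Suc.hyps(1)[of q] \<open>degree q = d\<close> \<open>q \<noteq> 0\<close> by blast
    qed
  qed
  obtain c where c: "\<exists>i\<in>{..CARD('m)}. c i \<noteq> 0" "(\<Sum>i\<le>CARD('m). c i *s (T ^^ i) y) = 0"
    using nontrivial_relation[of "{..CARD('m)}" "\<lambda>i. (T ^^ i) y"] by auto
  define p where "p = Abs_poly (\<lambda>i. if i \<le> CARD('m) then c i else 0)"
  have cp: "coeff p i = (if i \<le> CARD('m) then c i else 0)" for i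
    unfolding p_def by (rule coeff_Abs_poly[of "CARD('m)", THEN fun_cong]) auto
  have "degree p \<le> CARD('m)" by (rule degree_le) (simp add: cp)
  then have "act p y = 0" using c act_ext[of p "CARD('m)" y] by (simp add: cp)
  moreover have "p \<noteq> 0" using c cp by (metis atMost_iff coeff_0)
  ultimately have "\<exists>u c. u \<in> W \<and> u \<notin> V \<and> T u - c *s u \<in> V"
    using main[of p y] y vec.subspace_0[OF V] by simp
  then show thesis using that by blast
qed

definition kernel_at_most_line :: "('k::field, 'm::finite) form2 \<Rightarrow> bool" where
  "kernel_at_most_line \<omega> \<longleftrightarrow>
     (\<forall>x y. x \<noteq> 0 \<and> (\<forall>u. \<omega> x u = 0) \<and> (\<forall>u. \<omega> y u = 0) \<longrightarrow> (\<exists>c. y = c *s x))"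

lemma alternating_form2_add_mult:
  assumes "alternating_form2 \<omega>" "alternating_form2 \<omega>'"
  shows "alternating_form2 (\<lambda>x y. s * \<omega> x y + t * \<omega>' x y)"
  using assms unfolding alternating_form2_def Vector_Spaces.linear_iff
  by (auto simp: algebra_simps vector_space_over_itself.vector_space_axioms vec.vector_space_axioms)

lemma alternating_form2_coordinates:
  assumes "alternating_form2 \<omega>"
  shows "\<omega> x y = (\<Sum>j\<in>UNIV. \<omega> x (axis j 1) * y $ j)"
proof -
  have "\<omega> x y = \<omega> x (\<Sum>j\<in>UNIV. y $ j *s axis j 1)"
    by (simp add: basis_expansion)
  then show ?thesis
    by (simp add: alternating_form2_sum[OF assms] mult.commute)
qed

text \<open>
  Let \<open>\<chi> = B v\<close> and \<open>z = v - w\<close>, so that \<open>A v = 0\<close>, \<open>A z = a \<chi>\<close>, \<open>B v = \<chi>\<close>, \<open>B z = 0\<close>. Thus \<open>c z + a v\<close> is in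
  the kernel of \<open>A - c B\<close> for every \<open>c\<close>, a curve of kernels of degree one. On \<open>W = {u. \<chi> u = 0}\<close> the forms
  \<open>A u\<close> vanish on \<open>z\<close>, the kernel of \<open>B\<close>, and hence are of the form \<open>B (T u)\<close>; and \<open>T u\<close> is again in \<open>W\<close>. As
  \<open>W\<close> is larger than \<open>V = span {v, z}\<close>, there is an eigenvector \<open>u\<close> of \<open>T\<close> modulo \<open>V\<close>, with eigenvalue \<open>c\<close>.
  Then \<open>A - c B\<close> maps \<open>u\<close>, \<open>v\<close> and \<open>z\<close> to multiples of \<open>\<chi>\<close>, and has a kernel of dimension at least two.
\<close>

lemma no_kernel_line_of_degree_one:
  fixes A B :: "(complex, 'm::finite) form2"
  assumes A: "alternating_form2 A" and B: "alternating_form2 B"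
    and card: "CARD('m) \<ge> 4"
    and line: "\<And>s t. (s, t) \<noteq> (0, 0) \<Longrightarrow> kernel_at_most_line (\<lambda>x y. s * A x y + t * B x y)"
    and v: "\<And>y. A v y = 0"
    and w: "\<And>y. A w y = - a * B v y" "\<And>y. B w y = B v y"
    and a: "a \<noteq> 0" and nz: "B v e \<noteq> 0"
  shows False
proof -
  note Ad = alternating_form2D[OF A] and Bd = alternating_form2D[OF B]
  note Ac = alternating_form2_commute[OF A] and Bc = alternating_form2_commute[OF B]
  define z where "z = v - w"
  have z: "B z y = 0" "A z y = a * B v y" for y
    by (simp_all add: z_def Ad Bd v w)
  have "z \<noteq> 0" using z(2)[of e] a nz by (auto simp: Ad)
  define W where "W = {u. B v u = 0}"
  define V where "V = vec.span {v, z}"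
  have W: "vec.subspace W"
    unfolding W_def vec.subspace_def by (simp add: Bd)
  have V: "vec.subspace V" unfolding V_def by simp
  have "v \<in> W" by (simp add: W_def Bd)
  \<comment> \<open>Otherwise the whole space would be spanned by \<open>v\<close>, \<open>z\<close> and \<open>e\<close>.\<close>
  have "\<not> W \<subseteq> V"
  proof
    assume "W \<subseteq> V"
    have "x \<in> vec.span {v, z, e}" for x
    proof -
      have "x - (B v x / B v e) *s e \<in> W" using nz by (simp add: W_def Bd)
      then have "x - (B v x / B v e) *s e \<in> vec.span {v, z, e}"
        using \<open>W \<subseteq> V\<close> vec.span_mono[of "{v, z}" "{v, z, e}"] by (auto simp: V_def)
      moreover have "(B v x / B v e) *s e \<in> vec.span {v, z, e}"
        by (intro vec.span_scale vec.span_base) simp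
      ultimately show ?thesis using vec.span_add by fastforce
    qed
    then have "vec.dim (UNIV :: (complex ^ 'm) set) \<le> card {v, z, e}"
      by (intro vec.dim_le_card) auto
    moreover have "card {v, z, e} \<le> 3"
      by (simp add: card_insert_if)
    ultimately show False using card by (simp add: vec.dim_UNIV card_cart_basis)
  qed
  then obtain y where y: "y \<in> W" "y \<notin> V" by blast
  \<comment> \<open>The rank of \<open>B\<close> is one too small. Adding the square of a coordinate that does not vanish on
    the kernel \<open>z\<close> of \<open>B\<close> makes it invertible and does not change \<open>B\<close> where that coordinate is \<open>0\<close>.\<close>
  obtain i where i: "z $ i \<noteq> 0" using \<open>z \<noteq> 0\<close> by (auto simp: vec_eq_iff)
  define L where "L x = (\<chi> j. B x (axis j 1) + (if j = i then x $ i else 0))" for x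
  have L: "Vector_Spaces.linear (*s) (*s) L"
    unfolding L_def Vector_Spaces.linear_iff
    by (auto simp: vec_eq_iff Bd algebra_simps vec.vector_space_axioms)
  have Lz: "(\<Sum>j\<in>UNIV. L x $ j * y $ j) = B x y + x $ i * y $ i" for x y
  proof -
    have "L x $ j * y $ j = B x (axis j 1) * y $ j + (if j = i then x $ i * y $ i else 0)" for j
      by (simp add: L_def algebra_simps)
    then show ?thesis
      by (simp add: sum.distrib alternating_form2_coordinates[OF B, of x y])
  qed
  have "inj L"
    unfolding vec.linear_inj_iff_eq_0[OF L]
  proof (intro allI impI)
    fix x assume "L x = 0"
    then have 0: "B x y + x $ i * y $ i = 0" for y using Lz[of x y] by simp
    have "B x z = 0" using z Bc[of x z] by simp
    with 0[of z] i have xi: "x $ i = 0" by simp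
    have "kernel_at_most_line B" using line[of 0 1] by simp
    then obtain c where "x = c *s z"
      unfolding kernel_at_most_line_def using 0 xi \<open>z \<noteq> 0\<close> z by (metis add.right_neutral mult_zero_left)
    with xi i show "x = 0" by simp
  qed
  then obtain G where G: "Vector_Spaces.linear (*s) (*s) G" "\<And>x. L (G x) = x"
    using vec.linear_injective_isomorphism[OF L] by blast
  define T where "T x = G (\<chi> j. A x (axis j 1))" for x
  have T: "Vector_Spaces.linear (*s) (*s) T"
  proof -
    have "Vector_Spaces.linear (*s) (*s) (\<lambda>x. \<chi> j. A x (axis j 1))"
      unfolding Vector_Spaces.linear_iff by (auto simp: vec_eq_iff Ad vec.vector_space_axioms)
    from Vector_Spaces.linear_compose[OF this G(1)] show ?thesis by (simp add: T_def[abs_def] o_def)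
  qed
  have BT: "B (T x) y = A x y" if "x \<in> W" for x y
  proof -
    have *: "B (T x) y + T x $ i * y $ i = A x y" for y
      unfolding Lz[symmetric] by (simp add: T_def G alternating_form2_coordinates[OF A, of x y])
    have "A x z = 0" using z(2)[of x] Ac[of x z] that by (simp add: W_def)
    moreover have "B (T x) z = 0" using z(1) Bc[of "T x" z] by simp
    ultimately have "T x $ i = 0" using *[of z] i by simp
    then show ?thesis using *[of y] by simp
  qed
  have "T x \<in> W" if "x \<in> W" for x
    using BT[OF that, of v] v Ac[of x v] Bc[of v "T x"] by (simp add: W_def)
  then obtain u c where u: "u \<in> W" "u \<notin> V" "T u - c *s u \<in> V"
    using eigenvector_modulo_subspace[OF T W _ V y] by blast
  define \<omega> where "\<omega> = (\<lambda>x y. 1 * A x y + (- c) * B x y)"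
  have \<omega>: "kernel_at_most_line \<omega>" unfolding \<omega>_def by (rule line) simp
  have \<omega>d: "\<omega> (x + y) r = \<omega> x r + \<omega> y r" "\<omega> (x - y) r = \<omega> x r - \<omega> y r" "\<omega> (b *s x) r = b * \<omega> x r" for x y r b
    by (simp_all add: \<omega>_def Ad Bd algebra_simps)
  obtain k1 k2 where k: "T u - c *s u = k1 *s v + k2 *s z"
    using u(3) by (auto simp: V_def vec.span_insert vec.span_singleton algebra_simps)
  have \<omega>u: "\<omega> u r = k1 * B v r" for r
  proof -
    have "\<omega> u r = B (T u - c *s u) r" by (simp add: \<omega>_def BT[OF u(1)] Bd)
    then show ?thesis by (simp add: k Bd z)
  qed
  have \<omega>z: "\<omega> z r = a * B v r" for r by (simp add: \<omega>_def z)
  have \<omega>v: "\<omega> v r = - c * B v r" for r by (simp add: \<omega>_def v)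
  \<comment> \<open>Two combinations of \<open>u\<close>, \<open>v\<close> and \<open>z\<close> in which the multiples of \<open>B v\<close> cancel.\<close>
  define x where "x = c *s z + a *s v"
  define x' where "x' = a *s u - k1 *s z"
  have "\<omega> x r = 0" "\<omega> x' r = 0" for r
    by (simp_all add: x_def x'_def \<omega>d \<omega>u \<omega>z \<omega>v algebra_simps)
  moreover have "x \<noteq> 0"
  proof
    assume "x = 0"
    then have "B x e = 0" by (simp add: Bd)
    then show False using a nz by (simp add: x_def Bd z)
  qed
  ultimately obtain d where "x' = d *s x"
    using \<omega> unfolding kernel_at_most_line_def by blast
  then have "a *s u = d *s x + k1 *s z" by (simp add: x'_def algebra_simps)
  moreover have "d *s x + k1 *s z \<in> V"
    unfolding x_def V_def by (intro vec.span_add vec.span_scale vec.span_base) auto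
  ultimately have "a *s u \<in> V" by simp
  then have "(1 / a) *s (a *s u) \<in> V" by (rule vec.subspace_scale[OF V])
  with a u show False by simp
qed

section \<open>Symmetry of second derivatives\<close>

text \<open>
  Mean value estimate for \<open>\<sigma> \<mapsto> f (q + \<sigma> h + \<tau> k) - f (q + \<sigma> h)\<close> on \<open>[0, \<tau>]\<close>, whose
  derivative is \<open>\<tau> E k\<close> up to \<open>o(\<tau>)\<close>.
\<close>

lemma second_difference_estimate:
  fixes f :: "'a::real_normed_vector \<Rightarrow> 'b::real_normed_vector"
  assumes U: "open U" "q \<in> U"
    and D: "\<And>x. x \<in> U \<Longrightarrow> (f has_derivative D x) (at x)"
    and E: "((\<lambda>x. D x h) has_derivative E) (at q)"
    and e: "0 < e"
  shows "\<forall>\<^sub>F \<tau> in at_right 0.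
    norm ((f (q + \<tau> *\<^sub>R h + \<tau> *\<^sub>R k) - f (q + \<tau> *\<^sub>R h)) - (f (q + \<tau> *\<^sub>R k) - f q) - \<tau>\<^sup>2 *\<^sub>R E k)
      \<le> e * \<tau>\<^sup>2"
proof -
  define N where "N = norm h + norm k + 1"
  have N: "N > 0" "norm h \<le> N" "norm h + norm k \<le> N" by (auto simp: N_def add_nonneg_pos)
  interpret E: bounded_linear E using E by (rule has_derivative_bounded_linear)
  \<comment> \<open>Each of two derivatives is approximated with error \<open>e' \<tau> N\<close>, over an interval of length \<open>\<tau>\<close>.\<close>
  define e' where "e' = e / (2 * N)"
  have "e' > 0" using e N by (simp add: e'_def)
  then obtain d where d: "d > 0"
    "\<And>y. norm (y - q) < d \<Longrightarrow> norm (D y h - D q h - E (y - q)) \<le> e' * norm (y - q)"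
    using E unfolding has_derivative_at_alt by blast
  obtain d' where d': "d' > 0" "ball q d' \<subseteq> U"
    using U open_contains_ball by blast
  define b where "b = min d d' / N"
  have "b > 0" using d d' N by (simp add: b_def)
  have "norm ((f (q + \<tau> *\<^sub>R h + \<tau> *\<^sub>R k) - f (q + \<tau> *\<^sub>R h)) - (f (q + \<tau> *\<^sub>R k) - f q) - \<tau>\<^sup>2 *\<^sub>R E k)
      \<le> e * \<tau>\<^sup>2" if \<tau>: "0 < \<tau>" "\<tau> < b" for \<tau>
  proof -
    have tN: "\<tau> * N < d" "\<tau> * N < d'" using \<tau> N by (auto simp: b_def field_simps)
    have n1: "norm (\<sigma> *\<^sub>R h + \<tau> *\<^sub>R k) \<le> \<tau> * N" "norm (\<sigma> *\<^sub>R h) \<le> \<tau> * N" if "\<sigma> \<in> {0..\<tau>}" for \<sigma>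
    proof -
      have s: "norm (\<sigma> *\<^sub>R h) \<le> \<tau> * norm h" using that by (simp add: mult_right_mono)
      have "norm (\<sigma> *\<^sub>R h + \<tau> *\<^sub>R k) \<le> norm (\<sigma> *\<^sub>R h) + norm (\<tau> *\<^sub>R k)" by (rule norm_triangle_ineq)
      also have "\<dots> \<le> \<tau> * norm h + \<tau> * norm k" using s \<tau> by simp
      also have "\<dots> = \<tau> * (norm h + norm k)" by (simp add: algebra_simps)
      also have "\<dots> \<le> \<tau> * N" using \<tau> N by (intro mult_left_mono) auto
      finally show "norm (\<sigma> *\<^sub>R h + \<tau> *\<^sub>R k) \<le> \<tau> * N" .
      show "norm (\<sigma> *\<^sub>R h) \<le> \<tau> * N"
        using s mult_left_mono[OF N(2), of \<tau>] \<tau> by linarith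
    qed
    define g where "g \<sigma> = f (q + (\<sigma> *\<^sub>R h + \<tau> *\<^sub>R k)) - f (q + \<sigma> *\<^sub>R h) - \<sigma> *\<^sub>R \<tau> *\<^sub>R E k" for \<sigma>
    have inU: "q + y \<in> U" if "norm y \<le> \<tau> * N" for y
      using that tN d' by (auto simp: subset_iff dist_norm)
    have Dsc: "D y (s *\<^sub>R h) = s *\<^sub>R D y h" if "y \<in> U" for y s
      using D[OF that] by (simp add: has_derivative_bounded_linear linear_simps(5))
    have "norm (g \<tau> - g 0) \<le> (2 * e' * \<tau> * N) * norm (\<tau> - 0)"
    proof (rule differentiable_bound[where S = "{0..\<tau>}"])
      fix \<sigma> assume \<sigma>: "\<sigma> \<in> {0..\<tau>}"
      let ?y1 = "q + (\<sigma> *\<^sub>R h + \<tau> *\<^sub>R k)" and ?y2 = "q + \<sigma> *\<^sub>R h"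
      note U12 = inU[OF n1(1)[OF \<sigma>]] inU[OF n1(2)[OF \<sigma>]]
      let ?g' = "\<lambda>s. D ?y1 (s *\<^sub>R h) - D ?y2 (s *\<^sub>R h) - s *\<^sub>R \<tau> *\<^sub>R E k"
      have "((\<lambda>\<sigma>. f (q + (\<sigma> *\<^sub>R h + \<tau> *\<^sub>R k))) has_derivative (\<lambda>s. D ?y1 (s *\<^sub>R h))) (at \<sigma> within {0..\<tau>})"
        by (rule has_derivative_compose[where g = f and f = "\<lambda>\<sigma>. q + (\<sigma> *\<^sub>R h + \<tau> *\<^sub>R k)", OF _ D[OF U12(1)]]) (auto intro!: derivative_eq_intros)
      moreover have "((\<lambda>\<sigma>. f (q + \<sigma> *\<^sub>R h)) has_derivative (\<lambda>s. D ?y2 (s *\<^sub>R h))) (at \<sigma> within {0..\<tau>})"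
        by (rule has_derivative_compose[where g = f and f = "\<lambda>\<sigma>. q + \<sigma> *\<^sub>R h", OF _ D[OF U12(2)]]) (auto intro!: derivative_eq_intros)
      ultimately show "(g has_derivative ?g') (at \<sigma> within {0..\<tau>})"
        unfolding g_def by (auto intro!: derivative_eq_intros)
      have "norm (D ?y1 h - D ?y2 h - \<tau> *\<^sub>R E k) \<le> e' * (\<tau> * N) + e' * (\<tau> * N)"
      proof -
        have "D ?y1 h - D ?y2 h - \<tau> *\<^sub>R E k =
            (D ?y1 h - D q h - E (?y1 - q)) - (D ?y2 h - D q h - E (?y2 - q))"
          by (simp add: E.add E.scaleR)
        also have "norm \<dots> \<le> norm (D ?y1 h - D q h - E (?y1 - q)) + norm (D ?y2 h - D q h - E (?y2 - q))"
          by (rule norm_triangle_ineq4)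
        also have "\<dots> \<le> e' * norm (?y1 - q) + e' * norm (?y2 - q)"
          by (intro add_mono d(2)) (use n1[OF \<sigma>] tN in auto)
        also have "\<dots> \<le> e' * (\<tau> * N) + e' * (\<tau> * N)"
          using n1[OF \<sigma>] \<open>e' > 0\<close> by (intro add_mono mult_left_mono) auto
        finally show ?thesis .
      qed
      moreover have "?g' s = s *\<^sub>R (D ?y1 h - D ?y2 h - \<tau> *\<^sub>R E k)" for s
        using U12 by (simp add: Dsc scaleR_diff_right)
      ultimately have "norm (?g' s) \<le> (2 * e' * \<tau> * N) * norm s" for s
      proof -
        assume *: "norm (D ?y1 h - D ?y2 h - \<tau> *\<^sub>R E k) \<le> e' * (\<tau> * N) + e' * (\<tau> * N)"
          and **: "\<And>s. ?g' s = s *\<^sub>R (D ?y1 h - D ?y2 h - \<tau> *\<^sub>R E k)"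
        have "norm (?g' s) = \<bar>s\<bar> * norm (D ?y1 h - D ?y2 h - \<tau> *\<^sub>R E k)"
          unfolding ** by simp
        also have "\<dots> \<le> \<bar>s\<bar> * (e' * (\<tau> * N) + e' * (\<tau> * N))"
          using * by (rule mult_left_mono) simp
        finally show ?thesis by (simp add: mult_ac)
      qed
      then show "onorm ?g' \<le> 2 * e' * \<tau> * N"
        by (intro onorm_bound) (use \<open>e' > 0\<close> \<tau> N in auto)
    qed (use \<tau> in auto)
    also have "\<dots> = e * \<tau>\<^sup>2" using N \<tau> by (simp add: e'_def power2_eq_square)
    finally show ?thesis
      by (simp add: g_def power2_eq_square algebra_simps)
  qed
  then show ?thesis
    unfolding eventually_at_right_field using \<open>b > 0\<close> by auto
qed

text \<open>
  The second difference of \<open>f\<close> at \<open>q\<close> is symmetric in \<open>h\<close> and \<open>k\<close>, and it is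
  \<open>\<tau>\<^sup>2 E h k + o(\<tau>\<^sup>2)\<close>.
\<close>

lemma second_derivative_symmetric:
  fixes f :: "'a::real_normed_vector \<Rightarrow> 'b::real_normed_vector"
  assumes U: "open U" "q \<in> U"
    and D: "\<And>x. x \<in> U \<Longrightarrow> (f has_derivative D x) (at x)"
    and E: "\<And>h. ((\<lambda>x. D x h) has_derivative E h) (at q)"
  shows "E h k = E k h"
proof (rule ccontr)
  assume "E h k \<noteq> E k h"
  then have "norm (E h k - E k h) > 0" by simp
  then obtain e where e: "e > 0" "norm (E h k - E k h) = 3 * e"
    using that[of "norm (E h k - E k h) / 3"] by simp
  define X where "X \<tau> = (f (q + \<tau> *\<^sub>R h + \<tau> *\<^sub>R k) - f (q + \<tau> *\<^sub>R h)) - (f (q + \<tau> *\<^sub>R k) - f q)" for \<tau>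
  have X_swap: "X \<tau> = (f (q + \<tau> *\<^sub>R k + \<tau> *\<^sub>R h) - f (q + \<tau> *\<^sub>R k)) - (f (q + \<tau> *\<^sub>R h) - f q)" for \<tau>
  proof -
    have swap: "q + \<tau> *\<^sub>R h + \<tau> *\<^sub>R k = q + \<tau> *\<^sub>R k + \<tau> *\<^sub>R h" by (simp add: ac_simps)
    show ?thesis unfolding X_def swap by (simp add: algebra_simps)
  qed
  have "\<forall>\<^sub>F \<tau> in at_right 0. norm (X \<tau> - \<tau>\<^sup>2 *\<^sub>R E h k) \<le> e * \<tau>\<^sup>2"
    unfolding X_def by (rule second_difference_estimate[OF U D E e(1)])
  moreover have "\<forall>\<^sub>F \<tau> in at_right 0. norm (X \<tau> - \<tau>\<^sup>2 *\<^sub>R E k h) \<le> e * \<tau>\<^sup>2"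
    unfolding X_swap by (rule second_difference_estimate[OF U D E e(1)])
  moreover have "\<forall>\<^sub>F \<tau> in at_right (0::real). \<tau> > 0"
    by (simp add: eventually_at_right_less)
  ultimately have "\<forall>\<^sub>F \<tau> in at_right (0::real). False"
  proof eventually_elim
    case (elim \<tau>)
    have "\<tau>\<^sup>2 * (3 * e) = norm (\<tau>\<^sup>2 *\<^sub>R (E h k - E k h))"
      by (simp add: e(2))
    also have "\<tau>\<^sup>2 *\<^sub>R (E h k - E k h) = (X \<tau> - \<tau>\<^sup>2 *\<^sub>R E k h) - (X \<tau> - \<tau>\<^sup>2 *\<^sub>R E h k)"
      by (simp add: scaleR_diff_right)
    also have "norm \<dots> \<le> norm (X \<tau> - \<tau>\<^sup>2 *\<^sub>R E k h) + norm (X \<tau> - \<tau>\<^sup>2 *\<^sub>R E h k)"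
      by (rule norm_triangle_ineq4)
    also have "\<dots> \<le> e * \<tau>\<^sup>2 + e * \<tau>\<^sup>2"
      using elim by (intro add_mono)
    finally show False using elim(3) e(1) by simp
  qed
  then show False by (simp add: trivial_limit_at_right_real)
qed

lemma norm_axis:
  fixes a :: "'a::real_normed_vector"
  shows "norm (axis i a) = norm a"
proof -
  have "(norm (axis i a $ k))\<^sup>2 = (if k = i then (norm a)\<^sup>2 else 0)" for k
    by (simp add: axis_def)
  then show ?thesis
    by (simp add: norm_vec_def L2_set_def)
qed

lemma has_derivative_vec_componentwise:
  fixes f :: "'a::real_normed_vector \<Rightarrow> 'b::real_normed_vector ^ 'm::finite"
  assumes "\<And>i. ((\<lambda>x. f x $ i) has_derivative (\<lambda>h. f' h $ i)) F"
  shows "(f has_derivative f') F"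
proof -
  have axis: "bounded_linear (axis i :: 'b \<Rightarrow> 'b ^ 'm)" for i
    by (rule bounded_linear_intro[of _ 1]) (simp_all add: norm_axis, simp_all add: vec_eq_iff axis_def)
  have "((\<lambda>x. \<Sum>i\<in>UNIV. axis i (f x $ i)) has_derivative (\<lambda>h. \<Sum>i\<in>UNIV. axis i (f' h $ i))) F"
    by (intro has_derivative_sum bounded_linear.has_derivative[OF axis assms])
  moreover have "(\<Sum>i\<in>UNIV. axis i (x $ i)) = x" for x :: "'b ^ 'm"
    by (simp add: vec_eq_iff axis_def)
  ultimately show ?thesis by simp
qed

text \<open>
  The derivatives are given by coefficients in the scalar field. Over the complex numbers
  this makes them complex linear, although \<^const>\<open>has_derivative\<close> itself only knows real
  linearity.
\<close>

definition twice_differentiable_on ::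
  "('k::real_normed_field ^ 'm::finite) set \<Rightarrow> ('k ^ 'm \<Rightarrow> 'k) \<Rightarrow> bool" where
  "twice_differentiable_on U f \<longleftrightarrow>
     (\<exists>D E. (\<forall>x\<in>U. (f has_derivative (\<lambda>h. \<Sum>i\<in>UNIV. D i x * h $ i)) (at x)) \<and>
            (\<forall>i. \<forall>x\<in>U. (D i has_derivative (\<lambda>h. \<Sum>j\<in>UNIV. E i j x * h $ j)) (at x)))"

lemma smooth_imp_twice_differentiable:
  assumes "smooth_fun_on U f"
  shows "twice_differentiable_on U f"
proof -
  have "Ck_on (Suc (Suc 0)) U f" using assms unfolding smooth_fun_on_def by blast
  then obtain D where D: "\<forall>x\<in>U. (f has_derivative (\<lambda>h. \<Sum>i\<in>UNIV. D i x * h $ i)) (at x)"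
    "\<And>i. Ck_on (Suc 0) U (D i)" by auto
  have "\<exists>E. \<forall>x\<in>U. (D i has_derivative (\<lambda>h. \<Sum>j\<in>UNIV. E j x * h $ j)) (at x)" for i
    using D(2)[of i] unfolding Ck_on.simps(2) by blast
  then obtain E where "\<forall>i. \<forall>x\<in>U. (D i has_derivative (\<lambda>h. \<Sum>j\<in>UNIV. E i j x * h $ j)) (at x)"
    by metis
  then show ?thesis using D unfolding twice_differentiable_on_def by blast
qed

lemma sum_axis: "(\<Sum>j\<in>UNIV. c j * axis k 1 $ j) = (c k :: 'k::semiring_1)"
proof -
  have "(\<Sum>j\<in>UNIV. c j * axis k 1 $ j) = (\<Sum>j\<in>UNIV. if j = k then c j else 0)"
    by (rule sum.cong) (auto simp: axis_def)
  then show ?thesis by simp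
qed

lemma twice_differentiable_onE:
  fixes f :: "'k::real_normed_field ^ 'm::finite \<Rightarrow> 'k"
  assumes "twice_differentiable_on U f" "open U"
  obtains D E where "\<And>x. x \<in> U \<Longrightarrow> (f has_derivative (\<lambda>h. \<Sum>i\<in>UNIV. D i x * h $ i)) (at x)"
    and "\<And>i x. x \<in> U \<Longrightarrow> (D i has_derivative (\<lambda>h. \<Sum>j\<in>UNIV. E i j x * h $ j)) (at x)"
    and "\<And>i j x. x \<in> U \<Longrightarrow> E i j x = E j i x"
proof -
  obtain D E where D: "\<And>x. x \<in> U \<Longrightarrow> (f has_derivative (\<lambda>h. \<Sum>i\<in>UNIV. D i x * h $ i)) (at x)"
    and E: "\<And>i x. x \<in> U \<Longrightarrow> (D i has_derivative (\<lambda>h. \<Sum>j\<in>UNIV. E i j x * h $ j)) (at x)"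
    using assms unfolding twice_differentiable_on_def by blast
  have "E i j x = E j i x" if "x \<in> U" for i j x
  proof -
    have "((\<lambda>x. \<Sum>i\<in>UNIV. D i x * h $ i) has_derivative
        (\<lambda>k. \<Sum>i\<in>UNIV. (\<Sum>j\<in>UNIV. E i j x * k $ j) * h $ i)) (at x)" for h
      by (intro has_derivative_sum has_derivative_mult_left E that)
    from second_derivative_symmetric[OF assms(2) that D this, of "axis i 1" "axis j 1"]
    show ?thesis by (simp add: sum_axis)
  qed
  then show thesis using D E that by blast
qed

section \<open>Partial derivatives of holomorphic functions\<close>

lemma norm_scaled_axis: "norm (\<zeta> *s axis i (1 :: complex)) = norm \<zeta>"
proof -
  have "\<zeta> *s axis i (1 :: complex) = axis i \<zeta>"
    by (simp add: vec_eq_iff axis_def)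
  then show ?thesis by (simp only: norm_axis)
qed

text \<open>
  The one-variable Cauchy formula for the derivative on the complex line through \<open>x\<close> in
  direction \<open>i\<close>. It expresses a partial derivative of \<open>f\<close> by values of \<open>f\<close> only.
\<close>

lemma partial_derivative_circle_integral:
  fixes f :: "complex ^ 'm::finite \<Rightarrow> complex"
  assumes f: "\<And>y. y \<in> U \<Longrightarrow> (f has_derivative (\<lambda>h. \<Sum>i\<in>UNIV. D i y * h $ i)) (at y)"
    and r: "0 < r" "cball x r \<subseteq> U"
  shows "D i x = integral {0..1} (\<lambda>t. f (x + circlepath 0 r t *s axis i 1) / circlepath 0 r t)"
proof -
  define g where "g \<zeta> = f (x + \<zeta> *s axis i 1)" for \<zeta>
  have inU: "x + \<zeta> *s axis i 1 \<in> U" if "norm \<zeta> \<le> r" for \<zeta>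
    using that r(2) by (auto simp: subset_iff dist_norm norm_scaled_axis)
  have g: "(g has_field_derivative D i (x + \<zeta> *s axis i 1)) (at \<zeta>)" if "norm \<zeta> \<le> r" for \<zeta>
  proof -
    have "bounded_linear (\<lambda>\<zeta>. \<zeta> *s axis i (1::complex))"
      by (intro bounded_linear_intro[of _ 1])
         (simp_all add: norm_scaled_axis vec.scale_left_distrib scaleR_vec_def vec_eq_iff)
    then have "((\<lambda>\<zeta>. x + \<zeta> *s axis i 1) has_derivative (\<lambda>\<zeta>. \<zeta> *s axis i 1)) (at \<zeta>)"
      by (auto intro!: derivative_eq_intros bounded_linear_imp_has_derivative)
    from has_derivative_compose[OF this f[OF inU[OF that]]]
    have "(g has_derivative (\<lambda>s. \<Sum>k\<in>UNIV. (D k (x + \<zeta> *s axis i 1) * s) * axis i 1 $ k)) (at \<zeta>)"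
      unfolding g_def by (simp add: mult.assoc)
    then show ?thesis
      unfolding sum_axis has_field_derivative_def by simp
  qed
  have cont: "continuous_on (cball 0 r) g"
    by (rule continuous_at_imp_continuous_on) (auto intro!: DERIV_isCont g)
  have "g holomorphic_on ball 0 r"
    unfolding holomorphic_on_open[OF open_ball] by (metis g less_imp_le mem_ball_0)
  from Cauchy_derivative_integral_circlepath(2)[OF cont this, of 0] r(1)
  have "(g has_field_derivative
      1 / (2 * of_real pi * \<i>) * contour_integral (circlepath 0 r) (\<lambda>u. g u / u\<^sup>2)) (at 0)"
    by simp
  moreover have "(g has_field_derivative D i x) (at 0)"
    using g[of 0] r by simp
  ultimately have "D i x = 1 / (2 * of_real pi * \<i>) * contour_integral (circlepath 0 r) (\<lambda>u. g u / u\<^sup>2)"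
    using DERIV_unique by blast
  also have "contour_integral (circlepath 0 r) (\<lambda>u. g u / u\<^sup>2) =
     integral {0..1} (\<lambda>t. (2 * of_real pi * \<i>) * (g (circlepath 0 r t) / circlepath 0 r t))"
    unfolding contour_integral_integral
  proof (rule integral_cong)
    fix t :: real assume "t \<in> {0..1}"
    have "circlepath 0 r t \<noteq> 0" using r(1) by (simp add: circlepath)
    moreover have "vector_derivative (circlepath 0 r) (at t) = 2 * of_real pi * \<i> * circlepath 0 r t"
      by (subst vector_derivative_circlepath) (simp add: circlepath)
    ultimately show "g (circlepath 0 r t) / (circlepath 0 r t)\<^sup>2 * vector_derivative (circlepath 0 r) (at t) =
      (2 * of_real pi * \<i>) * (g (circlepath 0 r t) / circlepath 0 r t)"
      by (simp add: power2_eq_square)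
  qed
  also have "1 / (2 * of_real pi * \<i>) * \<dots> = integral {0..1} (\<lambda>t. g (circlepath 0 r t) / circlepath 0 r t)"
    by (simp only: integral_mult_right) simp
  finally show ?thesis by (simp add: g_def)
qed

lemma continuous_on_shifted_quotient:
  fixes F :: "complex ^ 'm::finite \<Rightarrow> complex"
  assumes "continuous_on U F" and r: "0 < r" and B: "\<And>x. x \<in> B \<Longrightarrow> cball x r \<subseteq> U"
  shows "continuous_on (B \<times> cbox 0 1)
    (\<lambda>(x, t). F (x + circlepath 0 r t *s axis i 1) / circlepath 0 r t)"
proof -
  have "norm (circlepath 0 r t) = r" for t
    using r by (simp add: circlepath norm_mult)
  then have "x + circlepath 0 r t *s axis i 1 \<in> U" if "x \<in> B" for x t
    using B[OF that] r by (auto simp: subset_iff dist_norm norm_scaled_axis)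
  moreover have "continuous_on (B \<times> cbox 0 1)
      (\<lambda>y :: (complex ^ 'm) \<times> real. fst y + circlepath 0 r (snd y) *s axis i 1)"
    unfolding vector_scalar_mult_def circlepath
    by (intro continuous_intros)
  ultimately have "continuous_on (B \<times> cbox 0 1)
      (\<lambda>y. F (fst y + circlepath 0 r (snd y) *s axis i 1))"
    using continuous_on_compose2[OF assms(1)] by fastforce
  moreover have "continuous_on (B \<times> cbox 0 1) (\<lambda>y :: (complex ^ 'm) \<times> real. circlepath 0 r (snd y))"
    unfolding circlepath by (intro continuous_intros)
  ultimately show ?thesis
    unfolding split_beta by (intro continuous_on_divide) (use r in \<open>auto simp: circlepath\<close>)
qed

lemma continuous_on_slice:
  assumes "continuous_on (A \<times> B) (\<lambda>(y, t). F y t)" "y \<in> A"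
  shows "continuous_on B (F y)"
proof -
  have "continuous_on B (\<lambda>t. (\<lambda>(y, t). F y t) (y, t))"
    by (rule continuous_on_compose2[OF assms(1)]) (use assms(2) in \<open>auto intro!: continuous_intros\<close>)
  then show ?thesis by simp
qed

lemma room_for_circles:
  fixes x :: "'a::metric_space"
  assumes "open U" "x \<in> U"
  obtains r where "r > 0" "\<And>y. y \<in> ball x r \<Longrightarrow> cball y r \<subseteq> U"
proof -
  obtain e where "e > 0" "ball x e \<subseteq> U" using assms open_contains_ball by blast
  moreover have "cball y (e / 3) \<subseteq> ball x e" if "y \<in> ball x (e / 3)" for y
  proof
    fix z assume "z \<in> cball y (e / 3)"
    with that \<open>e > 0\<close> dist_triangle[of x z y] show "z \<in> ball x e" by auto
  qed
  ultimately show thesis using that[of "e / 3"] by fastforce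
qed

text \<open>
  By the circle integral formula, continuity of \<open>f\<close> gives continuity of its partial derivatives. With this,
  differentiation under the integral sign applies to the same formula and shows that
  the partial derivatives are differentiable.
\<close>

lemma partial_derivatives_holomorphic:
  fixes f :: "complex ^ 'm::finite \<Rightarrow> complex"
  assumes U: "open U"
    and f: "\<And>x. x \<in> U \<Longrightarrow> (f has_derivative (\<lambda>h. \<Sum>i\<in>UNIV. D i x * h $ i)) (at x)"
  shows "holomorphic_fun_on U (D i)"
proof -
  have contf: "continuous_on U f"
    by (rule continuous_at_imp_continuous_on) (use f has_derivative_continuous in blast)
  have contD: "continuous_on U (D j)" for j
  proof (rule continuous_at_imp_continuous_on, rule ballI)
    fix x assume "x \<in> U"
    then obtain r where r: "r > 0" "\<And>y. y \<in> ball x r \<Longrightarrow> cball y r \<subseteq> U"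
      using room_for_circles U by blast
    have "continuous_on (ball x r)
        (\<lambda>y. integral (cbox 0 1) (\<lambda>t. f (y + circlepath 0 r t *s axis j 1) / circlepath 0 r t))"
      by (rule integral_continuous_on_param, rule continuous_on_shifted_quotient[OF contf r])
    then have "continuous_on (ball x r) (D j)"
      by (rule continuous_on_eq)
         (simp add: partial_derivative_circle_integral[OF f r(1) r(2)])
    then show "isCont (D j) x"
      using r(1) by (simp add: continuous_on_eq_continuous_at)
  qed
  show ?thesis
    unfolding holomorphic_fun_on_def
  proof
    fix x assume "x \<in> U"
    then obtain r where r: "r > 0" "\<And>y. y \<in> ball x r \<Longrightarrow> cball y r \<subseteq> U"
      using room_for_circles U by blast
    define c where "c j y t = D j (y + circlepath 0 r t *s axis i 1) / circlepath 0 r t" for j y t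
    have contc: "continuous_on (ball x r \<times> cbox 0 1) (\<lambda>(y, t). c j y t)" for j
      unfolding c_def by (rule continuous_on_shifted_quotient[OF contD r])
    define \<Phi> where "\<Phi> y t = (\<Sum>j\<in>UNIV. blinfun_mult_right (c j y t) o\<^sub>L Blinfun (\<lambda>h :: complex ^ 'm. h $ j))" for y t
    have \<Phi>: "blinfun_apply (\<Phi> y t) = (\<lambda>h. \<Sum>j\<in>UNIV. c j y t * h $ j)" for y t
      by (simp add: \<Phi>_def blinfun.sum_left bounded_linear_Blinfun_apply bounded_linear_vec_nth fun_eq_iff)
    have cont\<Phi>: "continuous_on (ball x r \<times> cbox 0 1) (\<lambda>(y, t). \<Phi> y t)"
      unfolding \<Phi>_def split_beta
      by (intro continuous_on_sum bounded_bilinear.continuous_on[OF bounded_bilinear_blinfun_compose]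
          bounded_linear.continuous_on[OF bounded_linear_blinfun_mult_right]
          continuous_on_const contc[unfolded split_beta])
    have x: "x \<in> ball x r" using r by simp
    have "((\<lambda>y. integral (cbox 0 1) (\<lambda>t. f (y + circlepath 0 r t *s axis i 1) / circlepath 0 r t))
        has_derivative integral (cbox 0 1) (\<Phi> x)) (at x within ball x r)"
    proof (rule leibniz_rule)
      fix y t assume y: "y \<in> ball x r"
      have "norm (circlepath 0 r t) = r"
        using r by (simp add: circlepath norm_mult)
      then have "y + circlepath 0 r t *s axis i 1 \<in> U"
        using r(2)[OF y] r(1) by (auto simp: subset_iff dist_norm norm_scaled_axis)
      from f[OF this]
      have "((\<lambda>y. f (y + circlepath 0 r t *s axis i 1)) has_derivative
          (\<lambda>h. \<Sum>j\<in>UNIV. D j (y + circlepath 0 r t *s axis i 1) * h $ j)) (at y within ball x r)"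
        by (rule has_derivative_compose[rotated, where f = "\<lambda>y. y + circlepath 0 r t *s axis i 1"])
           (auto intro!: derivative_eq_intros)
      then have "((\<lambda>y. f (y + circlepath 0 r t *s axis i 1) / circlepath 0 r t) has_derivative
          (\<lambda>h. (\<Sum>j\<in>UNIV. D j (y + circlepath 0 r t *s axis i 1) * h $ j) / circlepath 0 r t)) (at y within ball x r)"
        by (rule bounded_linear.has_derivative[OF bounded_linear_divide])
      then show "((\<lambda>y. f (y + circlepath 0 r t *s axis i 1) / circlepath 0 r t) has_derivative
          blinfun_apply (\<Phi> y t)) (at y within ball x r)"
        by (simp add: \<Phi> c_def sum_divide_distrib)
    next
      fix y assume y: "y \<in> ball x r"
      have "continuous_on (cbox 0 1) (\<lambda>t. f (y + circlepath 0 r t *s axis i 1) / circlepath 0 r t)"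
        by (rule continuous_on_slice[OF continuous_on_shifted_quotient[OF contf r] y])
      then show "(\<lambda>t. f (y + circlepath 0 r t *s axis i 1) / circlepath 0 r t) integrable_on cbox 0 1"
        by (rule integrable_continuous)
    next
      show "continuous_on (ball x r \<times> cbox 0 1) (\<lambda>(y, t). \<Phi> y t)"
        by (rule cont\<Phi>)
    qed (use r in auto)
    moreover have "blinfun_apply (integral (cbox 0 1) (\<Phi> x)) = (\<lambda>h. \<Sum>j\<in>UNIV. integral (cbox 0 1) (c j x) * h $ j)"
    proof
      fix h :: "complex ^ 'm"
      have int: "c j x integrable_on cbox 0 1" for j
        by (rule integrable_continuous[OF continuous_on_slice[OF contc x]])
      have "blinfun_apply (integral (cbox 0 1) (\<Phi> x)) h = integral (cbox 0 1) (\<lambda>t. \<Phi> x t h)"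
        by (rule blinfun_apply_integral[OF integrable_continuous[OF continuous_on_slice[OF cont\<Phi> x]]])
      also have "\<dots> = (\<Sum>j\<in>UNIV. integral (cbox 0 1) (\<lambda>t. c j x t * h $ j))"
        unfolding \<Phi> by (rule integral_sum[OF finite integrable_on_mult_left[OF int]])
      finally show "blinfun_apply (integral (cbox 0 1) (\<Phi> x)) h = (\<Sum>j\<in>UNIV. integral (cbox 0 1) (c j x) * h $ j)"
        by (simp only: integral_mult_left)
    qed
    ultimately have "((\<lambda>y. integral (cbox 0 1) (\<lambda>t. f (y + circlepath 0 r t *s axis i 1) / circlepath 0 r t))
        has_derivative (\<lambda>h. \<Sum>j\<in>UNIV. integral (cbox 0 1) (c j x) * h $ j)) (at x)"
      using r(1) by (simp add: at_within_open[of x "ball x r"])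
    then have "(D i has_derivative (\<lambda>h. \<Sum>j\<in>UNIV. integral (cbox 0 1) (c j x) * h $ j)) (at x)"
      by (rule has_derivative_transform_within_open[OF _ open_ball x])
         (use r in \<open>auto simp: partial_derivative_circle_integral[OF f r(1) r(2)]\<close>)
    then show "\<exists>d. (D i has_derivative (\<lambda>h. \<Sum>j\<in>UNIV. d j * h $ j)) (at x)"
      by (rule exI[of _ "\<lambda>j. integral (cbox 0 1) (c j x)"])
  qed
qed

lemma holomorphic_imp_twice_differentiable:
  assumes "open U" "holomorphic_fun_on U f"
  shows "twice_differentiable_on U f"
proof -
  obtain d where "\<And>x. x \<in> U \<Longrightarrow> (f has_derivative (\<lambda>h. \<Sum>i\<in>UNIV. d x i * h $ i)) (at x)"
    using assms(2) unfolding holomorphic_fun_on_def by metis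
  then have D: "\<And>x. x \<in> U \<Longrightarrow> (f has_derivative (\<lambda>h. \<Sum>i\<in>UNIV. (\<lambda>i x. d x i) i x * h $ i)) (at x)"
    by simp
  have "\<forall>i x. \<exists>e. x \<in> U \<longrightarrow> ((\<lambda>x. d x i) has_derivative (\<lambda>h. \<Sum>j\<in>UNIV. e j * h $ j)) (at x)"
    using partial_derivatives_holomorphic[OF assms(1) D] unfolding holomorphic_fun_on_def by blast
  then obtain e where "\<And>i x. x \<in> U \<Longrightarrow> ((\<lambda>x. d x i) has_derivative (\<lambda>h. \<Sum>j\<in>UNIV. e i x j * h $ j)) (at x)"
    by metis
  then show ?thesis
    unfolding twice_differentiable_on_def
    using D by (intro exI[of _ "\<lambda>i x. d x i"] exI[of _ "\<lambda>i j x. e i x j"]) simp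
qed

section \<open>Divergence in coordinates with constant coefficients\<close>

lemma sum_antisymmetric_times_symmetric:
  fixes C S :: "'i::finite \<Rightarrow> 'i \<Rightarrow> 'k::{idom,ring_char_0}"
  assumes C: "\<And>i j. C i j = - C j i" and S: "\<And>i j. S j i = S i j"
  shows "(\<Sum>i\<in>UNIV. \<Sum>j\<in>UNIV. C i j * S j i) = 0"
proof -
  define s where "s = (\<Sum>i\<in>UNIV. \<Sum>j\<in>UNIV. C i j * S j i)"
  have "C i j * S j i = - (C j i * S i j)" for i j
    using C[of i j] S[of i j] by simp
  then have "s = (\<Sum>i\<in>UNIV. \<Sum>j\<in>UNIV. - (C j i * S i j))"
    unfolding s_def by (intro sum.cong refl)
  also have "\<dots> = - s"
    unfolding s_def sum_negf by (subst sum.swap) (rule refl)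
  finally have "s + s = 0" by (rule eq_neg_iff_add_eq_0[THEN iffD1])
  then have "2 * s = 0" by (simp only: mult_2)
  then show ?thesis by (simp add: s_def)
qed

text \<open>
  Let \<open>J\<close> be the Jacobian of \<open>\<phi>\<close> and \<open>K\<close> that of its inverse \<open>\<psi>\<close>, taken at \<open>\<phi> x\<close>. Constant coefficients \<open>C\<close> mean
  \<open>\<Lambda>\<^sub>k\<^sub>l = \<Sum>\<^sub>i\<^sub>j C\<^sub>i\<^sub>j K\<^sub>k\<^sub>i K\<^sub>l\<^sub>j\<close>. In the divergence \<open>\<Sum>\<^sub>k \<partial>\<^sub>k \<Lambda>\<^sub>k\<^sub>l\<close> the derivative of the second factor contributes
  \<open>\<Sum>\<^sub>i\<^sub>j C\<^sub>i\<^sub>j \<partial>\<^sub>i \<partial>\<^sub>j \<psi>\<^sub>l = 0\<close>, since \<open>C\<close> is antisymmetric. The derivative of the first factor contributes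
  \<open>\<Lambda>(v, e\<^sub>l)\<close> with \<open>v = \<Sum>\<^sub>i u\<^sub>i d\<phi>\<^sub>i\<close>, \<open>u\<^sub>i = \<Sum>\<^sub>k \<partial>\<^sub>k K\<^sub>k\<^sub>i\<close>. The vector \<open>v\<close>, which is the logarithmic differential of
  the coordinate volume up to sign, depends on the coordinates but not on \<open>\<Lambda>\<close>; hence it serves both
  members of a pair. The coefficients \<open>\<Lambda>'\<close> are the partial derivatives of \<open>\<Lambda>\<close> at \<open>p\<close>.
\<close>

lemma divergence_in_flat_coordinates:
  fixes \<phi> :: "'k::real_normed_field ^ 'm::finite \<Rightarrow> 'k ^ 'm"
  assumes coords: "local_coordinates reg p U \<phi>"
    and reg: "\<And>V f. open V \<Longrightarrow> reg V f \<Longrightarrow> twice_differentiable_on V f"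
  obtains v where "\<And>\<Lambda> \<Lambda>' l. (\<And>x. x \<in> U \<Longrightarrow> alternating_form2 (\<Lambda> x)) \<Longrightarrow>
      constant_coefficients U \<phi> \<Lambda> \<Longrightarrow>
      (\<And>k l. ((\<lambda>x. \<Lambda> x (axis k 1) (axis l 1)) has_derivative (\<lambda>h. \<Sum>s\<in>UNIV. \<Lambda>' s k l * h $ s)) (at p)) \<Longrightarrow>
      \<Lambda> p v (axis l 1) = (\<Sum>k\<in>UNIV. \<Lambda>' k k l)"
proof -
  from coords have U: "open U" "p \<in> U" and \<phi>U: "open (\<phi> ` U)"
    and reg\<phi>: "\<And>i. reg U (\<lambda>x. \<phi> x $ i)"
    unfolding local_coordinates_def by auto
  from coords obtain \<psi> :: "'k ^ 'm \<Rightarrow> 'k ^ 'm" where \<psi>\<phi>: "\<And>x. x \<in> U \<Longrightarrow> \<psi> (\<phi> x) = x"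
    and reg\<psi>: "\<And>i. reg (\<phi> ` U) (\<lambda>y. \<psi> y $ i)"
    unfolding local_coordinates_def by auto
  have "\<exists>J. \<forall>x\<in>U. ((\<lambda>x. \<phi> x $ i) has_derivative (\<lambda>h. \<Sum>k\<in>UNIV. J k x * h $ k)) (at x)" for i
    by (rule twice_differentiable_onE[OF reg[OF U(1) reg\<phi>[of i]] U(1)]) blast
  then have "\<exists>J. \<forall>i. \<forall>x\<in>U. ((\<lambda>x. \<phi> x $ i) has_derivative (\<lambda>h. \<Sum>k\<in>UNIV. J i k x * h $ k)) (at x)"
    by (intro choice allI)
  then obtain J where J: "\<And>i x. x \<in> U \<Longrightarrow>
      ((\<lambda>x. \<phi> x $ i) has_derivative (\<lambda>h. \<Sum>k\<in>UNIV. J i k x * h $ k)) (at x)"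
    by blast
  have "\<exists>K H. (\<forall>y\<in>\<phi> ` U. ((\<lambda>y. \<psi> y $ l) has_derivative (\<lambda>h. \<Sum>j\<in>UNIV. K j y * h $ j)) (at y)) \<and>
     (\<forall>j. \<forall>y\<in>\<phi> ` U. (K j has_derivative (\<lambda>h. \<Sum>i\<in>UNIV. H j i y * h $ i)) (at y)) \<and>
     (\<forall>i j. \<forall>y\<in>\<phi> ` U. H j i y = H i j y)" for l
  proof -
    obtain D E where "\<And>y. y \<in> \<phi> ` U \<Longrightarrow> ((\<lambda>y. \<psi> y $ l) has_derivative (\<lambda>h. \<Sum>j\<in>UNIV. D j y * h $ j)) (at y)"
      "\<And>j y. y \<in> \<phi> ` U \<Longrightarrow> (D j has_derivative (\<lambda>h. \<Sum>i\<in>UNIV. E j i y * h $ i)) (at y)"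
      "\<And>j i y. y \<in> \<phi> ` U \<Longrightarrow> E j i y = E i j y"
      by (rule twice_differentiable_onE[OF reg[OF \<phi>U reg\<psi>[of l]] \<phi>U]) (rule that)
    then show ?thesis by (intro exI[of _ D] exI[of _ E]) blast
  qed
  then have "\<exists>K H. \<forall>l. (\<forall>y\<in>\<phi> ` U. ((\<lambda>y. \<psi> y $ l) has_derivative (\<lambda>h. \<Sum>j\<in>UNIV. K l j y * h $ j)) (at y)) \<and>
     (\<forall>j. \<forall>y\<in>\<phi> ` U. (K l j has_derivative (\<lambda>h. \<Sum>i\<in>UNIV. H l j i y * h $ i)) (at y)) \<and>
     (\<forall>i j. \<forall>y\<in>\<phi> ` U. H l j i y = H l i j y)"
    by (subst choice_iff[symmetric], subst choice_iff[symmetric]) blast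
  then obtain K H where KH: "\<forall>l. (\<forall>y\<in>\<phi> ` U. ((\<lambda>y. \<psi> y $ l) has_derivative (\<lambda>h. \<Sum>j\<in>UNIV. K l j y * h $ j)) (at y)) \<and>
     (\<forall>j. \<forall>y\<in>\<phi> ` U. (K l j has_derivative (\<lambda>h. \<Sum>i\<in>UNIV. H l j i y * h $ i)) (at y)) \<and>
     (\<forall>i j. \<forall>y\<in>\<phi> ` U. H l j i y = H l i j y)"
    by (elim exE) (rule that)
  have K: "\<And>l y. y \<in> \<phi> ` U \<Longrightarrow> ((\<lambda>y. \<psi> y $ l) has_derivative (\<lambda>h. \<Sum>j\<in>UNIV. K l j y * h $ j)) (at y)"
    using KH[THEN spec, THEN conjunct1] by (rule bspec)
  have H: "\<And>l j y. y \<in> \<phi> ` U \<Longrightarrow> (K l j has_derivative (\<lambda>h. \<Sum>i\<in>UNIV. H l j i y * h $ i)) (at y)"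
    using KH[THEN spec, THEN conjunct2, THEN conjunct1, THEN spec] by (rule bspec)
  have Hsym: "\<And>l i j y. y \<in> \<phi> ` U \<Longrightarrow> H l j i y = H l i j y"
    using KH[THEN spec, THEN conjunct2, THEN conjunct2, THEN spec, THEN spec] by (rule bspec)
  have d\<phi>: "(\<phi> has_derivative (\<lambda>h. \<chi> i. \<Sum>k\<in>UNIV. J i k x * h $ k)) (at x)" if "x \<in> U" for x
    by (rule has_derivative_vec_componentwise) (simp add: J[OF that])
  have KJ: "(\<Sum>j\<in>UNIV. K l j (\<phi> x) * J j k x) = (if l = k then 1 else 0)" if x: "x \<in> U" for x l k
  proof -
    have "((\<lambda>x. \<psi> (\<phi> x) $ l) has_derivative
        (\<lambda>h. \<Sum>j\<in>UNIV. K l j (\<phi> x) * (\<Sum>k\<in>UNIV. J j k x * h $ k))) (at x)"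
      using has_derivative_compose[OF d\<phi>[OF x] K[of "\<phi> x" l]] x by simp
    then have "((\<lambda>x. x $ l) has_derivative
        (\<lambda>h. \<Sum>j\<in>UNIV. K l j (\<phi> x) * (\<Sum>k\<in>UNIV. J j k x * h $ k))) (at x)"
      by (rule has_derivative_transform_within_open[OF _ U(1) x]) (simp add: \<psi>\<phi>)
    moreover have "((\<lambda>x. x $ l) has_derivative (\<lambda>h. h $ l)) (at x)"
      by (rule bounded_linear_imp_has_derivative[OF bounded_linear_vec_nth])
    ultimately have "(\<lambda>h. \<Sum>j\<in>UNIV. K l j (\<phi> x) * (\<Sum>k\<in>UNIV. J j k x * h $ k)) = (\<lambda>h. h $ l)"
      by (rule has_derivative_unique)
    from fun_cong[OF this, of "axis k 1"] show ?thesis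
      by (simp add: sum_axis) (simp add: axis_def)
  qed
  have JK: "(\<Sum>k\<in>UNIV. J r k p * K k i (\<phi> p)) = (if r = i then 1 else 0)" for r i
  proof -
    have "(\<chi> l j. K l j (\<phi> p)) ** (\<chi> j k. J j k p) = mat 1"
      using KJ[OF U(2)] by (simp add: matrix_matrix_mult_def mat_def vec_eq_iff)
    then have "(\<chi> j k. J j k p) ** (\<chi> l j. K l j (\<phi> p)) = mat 1"
      by (simp add: matrix_left_right_inverse)
    then show ?thesis
      by (simp add: matrix_matrix_mult_def mat_def vec_eq_iff)
  qed
  have diff: "differential (\<lambda>z. \<phi> z $ i) x = (\<chi> k. J i k x)" if "x \<in> U" for x i
    unfolding differential_def
    using frechet_derivative_at[OF J[OF that, of i], symmetric] by (simp add: sum_axis)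
  define u where "u i = (\<Sum>k\<in>UNIV. \<Sum>r\<in>UNIV. H k i r (\<phi> p) * J r k p)" for i
  define v where "v = (\<Sum>i\<in>UNIV. u i *s (\<chi> k. J i k p))"
  show thesis
  proof (rule that[of v])
    fix \<Lambda> :: "('k, 'm) bivector_field" and \<Lambda>' l
    assume alt: "\<And>x. x \<in> U \<Longrightarrow> alternating_form2 (\<Lambda> x)"
      and const: "constant_coefficients U \<phi> \<Lambda>"
      and d\<Lambda>: "\<And>k l. ((\<lambda>x. \<Lambda> x (axis k 1) (axis l 1)) has_derivative (\<lambda>h. \<Sum>s\<in>UNIV. \<Lambda>' s k l * h $ s)) (at p)"
    from const obtain C where C: "\<Lambda> x (\<chi> k. J i k x) (\<chi> k. J j k x) = C i j" if "x \<in> U" for x i j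
      unfolding constant_coefficients_def using diff by metis
    have Csym: "C i j = - C j i" for i j
      using alternating_form2_commute[OF alt[OF U(2)]] C[OF U(2)] by metis
    have axis: "axis k 1 = (\<Sum>i\<in>UNIV. K k i (\<phi> x) *s (\<chi> j. J i j x))" if "x \<in> U" for x k
      using KJ[OF that, of k] by (simp add: vec_eq_iff axis_def)
    have \<Lambda>: "\<Lambda> x (axis k 1) (axis l 1) = (\<Sum>i\<in>UNIV. \<Sum>j\<in>UNIV. C i j * (K k i (\<phi> x) * K l j (\<phi> x)))"
      if x: "x \<in> U" for x k l
      unfolding axis[OF x] by (simp add: alternating_form2_sum[OF alt[OF x]] C[OF x] sum_distrib_left mult_ac, rule sum.swap)
    have dK: "((\<lambda>x. K l j (\<phi> x)) has_derivative
        (\<lambda>h. \<Sum>r\<in>UNIV. H l j r (\<phi> p) * (\<Sum>s\<in>UNIV. J r s p * h $ s))) (at p)" for l j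
      using has_derivative_compose[OF d\<phi>[OF U(2)] H[of "\<phi> p" l j]] U(2) by simp
    have "\<Lambda>' s k l = (\<Sum>i\<in>UNIV. \<Sum>j\<in>UNIV. C i j *
        (K k i (\<phi> p) * (\<Sum>r\<in>UNIV. H l j r (\<phi> p) * J r s p) +
         (\<Sum>r\<in>UNIV. H k i r (\<phi> p) * J r s p) * K l j (\<phi> p)))" for s k
    proof -
      have "((\<lambda>x. \<Sum>i\<in>UNIV. \<Sum>j\<in>UNIV. C i j * (K k i (\<phi> x) * K l j (\<phi> x))) has_derivative
        (\<lambda>h. \<Sum>i\<in>UNIV. \<Sum>j\<in>UNIV. C i j *
         (K k i (\<phi> p) * (\<Sum>r\<in>UNIV. H l j r (\<phi> p) * (\<Sum>s\<in>UNIV. J r s p * h $ s)) +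
         (\<Sum>r\<in>UNIV. H k i r (\<phi> p) * (\<Sum>s\<in>UNIV. J r s p * h $ s)) * K l j (\<phi> p)))) (at p)"
        by (intro has_derivative_sum has_derivative_mult_right has_derivative_mult dK)
      then have "((\<lambda>x. \<Lambda> x (axis k 1) (axis l 1)) has_derivative
        (\<lambda>h. \<Sum>i\<in>UNIV. \<Sum>j\<in>UNIV. C i j *
         (K k i (\<phi> p) * (\<Sum>r\<in>UNIV. H l j r (\<phi> p) * (\<Sum>s\<in>UNIV. J r s p * h $ s)) +
         (\<Sum>r\<in>UNIV. H k i r (\<phi> p) * (\<Sum>s\<in>UNIV. J r s p * h $ s)) * K l j (\<phi> p)))) (at p)"
        by (rule has_derivative_transform_within_open[OF _ U]) (simp add: \<Lambda>)
      from fun_cong[OF has_derivative_unique[OF d\<Lambda> this], of "axis s 1"]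
      show ?thesis by (simp add: sum_axis)
    qed
    then have "(\<Sum>k\<in>UNIV. \<Lambda>' k k l) =
        (\<Sum>k\<in>UNIV. \<Sum>i\<in>UNIV. \<Sum>j\<in>UNIV. \<Sum>r\<in>UNIV. C i j * H l j r (\<phi> p) * (J r k p * K k i (\<phi> p))) +
        (\<Sum>k\<in>UNIV. \<Sum>i\<in>UNIV. \<Sum>j\<in>UNIV. C i j * K l j (\<phi> p) * (\<Sum>r\<in>UNIV. H k i r (\<phi> p) * J r k p))"
      (is "_ = ?S1 + ?S2")
      by (simp add: sum.distrib[symmetric] sum_distrib_left algebra_simps)
    also have "?S1 = 0"
    proof -
      \<comment> \<open>Summation over \<open>k\<close> first turns the derivative along \<open>e\<^sub>k\<close> into one along a coordinate of \<open>\<phi>\<close>.\<close>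
      have "?S1 = (\<Sum>i\<in>UNIV. \<Sum>j\<in>UNIV. \<Sum>r\<in>UNIV. \<Sum>k\<in>UNIV. C i j * H l j r (\<phi> p) * (J r k p * K k i (\<phi> p)))"
        by (subst sum.swap, rule sum.cong[OF refl], subst sum.swap, rule sum.cong[OF refl], subst sum.swap, rule refl)
      also have "\<dots> = (\<Sum>i\<in>UNIV. \<Sum>j\<in>UNIV. \<Sum>r\<in>UNIV. C i j * H l j r (\<phi> p) * (if r = i then 1 else 0))"
        by (simp only: sum_distrib_left[symmetric] JK)
      also have "\<dots> = (\<Sum>i\<in>UNIV. \<Sum>j\<in>UNIV. C i j * H l j i (\<phi> p))" (is "_ = ?S")
        by (simp add: if_distrib cong: if_cong)
      also have "?S = 0"
        by (rule sum_antisymmetric_times_symmetric[where C = C and S = "\<lambda>j i. H l j i (\<phi> p)"])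
           (rule Csym, rule Hsym, rule imageI, rule U)
      finally show ?thesis .
    qed
    also have "?S2 = (\<Sum>i\<in>UNIV. \<Sum>j\<in>UNIV. C i j * K l j (\<phi> p) * u i)"
      unfolding u_def sum_distrib_left
      by (subst sum.swap, rule sum.cong[OF refl], subst sum.swap, rule refl)
    also have "\<dots> = \<Lambda> p v (axis l 1)"
      unfolding axis[OF U(2)] v_def
      by (simp add: alternating_form2_sum[OF alt[OF U(2)]] C[OF U(2)] sum_distrib_left mult_ac, rule sum.swap)
    finally show "\<Lambda> p v (axis l 1) = (\<Sum>k\<in>UNIV. \<Lambda>' k k l)" by simp
  qed
qed

section \<open>Complexification\<close>

definition scalar_embedding :: "('k::field \<Rightarrow> complex) \<Rightarrow> bool" where
  "scalar_embedding \<iota> \<longleftrightarrow>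
     (\<forall>x y. \<iota> (x + y) = \<iota> x + \<iota> y) \<and> (\<forall>x y. \<iota> (x * y) = \<iota> x * \<iota> y) \<and> (\<forall>x. \<iota> x = 0 \<longleftrightarrow> x = 0)"

lemma scalar_embeddingD:
  assumes "scalar_embedding \<iota>"
  shows "\<iota> (x + y) = \<iota> x + \<iota> y" "\<iota> (x * y) = \<iota> x * \<iota> y" "\<iota> x = 0 \<longleftrightarrow> x = 0"
    "\<iota> (- x) = - \<iota> x" "\<iota> 0 = 0" "\<iota> (sum f I) = (\<Sum>i\<in>I. \<iota> (f i))"
proof -
  show add: "\<iota> (x + y) = \<iota> x + \<iota> y" for x y
    using assms by (simp add: scalar_embedding_def)
  show "\<iota> (x * y) = \<iota> x * \<iota> y" "\<iota> x = 0 \<longleftrightarrow> x = 0"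
    using assms by (simp_all add: scalar_embedding_def)
  show zero: "\<iota> 0 = 0"
    using assms by (simp add: scalar_embedding_def)
  show "\<iota> (- x) = - \<iota> x"
    using add[of x "- x"] zero by (simp add: add_eq_0_iff)
  show "\<iota> (sum f I) = (\<Sum>i\<in>I. \<iota> (f i))"
    by (induction I rule: infinite_finite_induct) (simp_all add: zero add)
qed

definition complexify_vec :: "('k \<Rightarrow> complex) \<Rightarrow> 'k ^ 'm \<Rightarrow> complex ^ 'm" where
  "complexify_vec \<iota> x = (\<chi> i. \<iota> (x $ i))"

definition complexify_form :: "('k::field \<Rightarrow> complex) \<Rightarrow> ('k, 'm::finite) form2 \<Rightarrow> (complex, 'm) form2" where
  "complexify_form \<iota> \<omega> x y =
     (\<Sum>i\<in>UNIV. \<Sum>j\<in>UNIV. \<iota> (\<omega> (axis i 1) (axis j 1)) * (x $ i * y $ j))"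

lemma alternating_complexify_form:
  assumes \<iota>: "scalar_embedding \<iota>" and \<omega>: "alternating_form2 \<omega>"
  shows "alternating_form2 (complexify_form \<iota> \<omega>)"
proof -
  have "complexify_form \<iota> \<omega> x x = 0" for x
  proof -
    have "(\<Sum>i\<in>UNIV. \<Sum>j\<in>UNIV. \<iota> (\<omega> (axis i 1) (axis j 1)) * (x $ j * x $ i)) = 0"
    proof (rule sum_antisymmetric_times_symmetric[where S = "\<lambda>j i. x $ j * x $ i"])
      show "\<iota> (\<omega> (axis i 1) (axis j 1)) = - \<iota> (\<omega> (axis j 1) (axis i 1))" for i j
        using alternating_form2_commute[OF \<omega>, of "axis i 1" "axis j 1"]
        by (simp add: scalar_embeddingD(4)[OF \<iota>])
    qed simp
    then show ?thesis unfolding complexify_form_def by (simp add: mult_ac)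
  qed
  then show ?thesis
    unfolding alternating_form2_def Vector_Spaces.linear_iff
    by (auto simp: complexify_form_def vec.vector_space_axioms
        vector_space_over_itself.vector_space_axioms algebra_simps sum.distrib sum_distrib_left)
qed

lemma complexify_form_left:
  assumes \<iota>: "scalar_embedding \<iota>" and \<omega>: "alternating_form2 \<omega>"
  shows "complexify_form \<iota> \<omega> (complexify_vec \<iota> x) y = (\<Sum>j\<in>UNIV. \<iota> (\<omega> x (axis j 1)) * y $ j)"
proof -
  have "\<omega> x (axis j 1) = (\<Sum>i\<in>UNIV. x $ i * \<omega> (axis i 1) (axis j 1))" for j
    using alternating_form2_sum(1)[OF \<omega>, of "\<lambda>i. x $ i" "\<lambda>i. axis i 1" UNIV]
    by (simp add: basis_expansion)
  then show ?thesis
    unfolding complexify_form_def complexify_vec_def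
    by (subst sum.swap) (simp add: scalar_embeddingD[OF \<iota>] sum_distrib_left sum_distrib_right mult_ac)
qed

lemma complexify_form_complexify_vec:
  assumes \<iota>: "scalar_embedding \<iota>" and \<omega>: "alternating_form2 \<omega>"
  shows "complexify_form \<iota> \<omega> (complexify_vec \<iota> x) (complexify_vec \<iota> y) = \<iota> (\<omega> x y)"
  unfolding complexify_form_left[OF \<iota> \<omega>] alternating_form2_coordinates[OF \<omega>, of x y]
  by (simp add: complexify_vec_def scalar_embeddingD[OF \<iota>])

text \<open>
  In dimension \<open>2 k + 1\<close> a kernel of dimension two kills the \<open>k\<close>-th power; genericity is
  tested on vectors over the original scalars, which the pullback accounts for.
\<close>

lemma generic_couple_kernel_at_most_line:
  fixes \<omega> \<omega>1 :: "('k::field, 'm::finite) form2"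
  assumes odd: "odd CARD('m)" "CARD('m) \<ge> 3"
    and \<iota>: "scalar_embedding \<iota>" and \<omega>: "alternating_form2 \<omega>" and \<omega>1: "alternating_form2 \<omega>1"
    and generic: "generic_couple \<iota> \<omega> \<omega>1" and st: "(s, t) \<noteq> (0, 0)"
  shows "kernel_at_most_line (\<lambda>x y. s * complexify_form \<iota> \<omega> x y + t * complexify_form \<iota> \<omega>1 x y)"
    (is "kernel_at_most_line ?\<Omega>")
proof (rule ccontr)
  assume "\<not> kernel_at_most_line ?\<Omega>"
  then obtain x y where xy: "x \<noteq> 0" "\<And>u. ?\<Omega> x u = 0" "\<And>u. ?\<Omega> y u = 0" "\<And>c. y \<noteq> c *s x"
    unfolding kernel_at_most_line_def by blast
  let ?k = "(CARD('m) - 1) div 2"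
  have alt: "alternating_form2 ?\<Omega>"
    by (intro alternating_form2_add_mult alternating_complexify_form \<iota> \<omega> \<omega>1)
  have k: "0 < ?k" "CARD('m) < 2 * ?k + 2"
    using odd by presburger+
  have "wedge_power2 (\<lambda>a b. s * \<iota> (\<omega> a b) + t * \<iota> (\<omega>1 a b)) ?k v = 0" for v
  proof -
    have "(\<lambda>a b. s * \<iota> (\<omega> a b) + t * \<iota> (\<omega>1 a b)) =
        (\<lambda>a b. ?\<Omega> (complexify_vec \<iota> a) (complexify_vec \<iota> b))"
      by (simp add: complexify_form_complexify_vec \<iota> \<omega> \<omega>1)
    then have "wedge_power2 (\<lambda>a b. s * \<iota> (\<omega> a b) + t * \<iota> (\<omega>1 a b)) ?k v =
        wedge_power2 ?\<Omega> ?k (complexify_vec \<iota> \<circ> v)"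
      by (simp only: wedge_power2_pullback[of ?\<Omega> "complexify_vec \<iota>" ?k v])
    also have "\<dots> = 0"
      by (rule wedge_power2_eq_0_if_degenerate[OF alt k xy(2) xy(1) xy(3) xy(4)])
    finally show ?thesis .
  qed
  then show False
    using generic st unfolding generic_couple_def by blast
qed

section \<open>Linear Poisson pairs\<close>

lemma lie_algebraD:
  assumes "lie_algebra br"
  shows "Vector_Spaces.linear (*s) (*s) (\<lambda>b. br a b)" "Vector_Spaces.linear (*s) (*s) (\<lambda>a. br a b)"
    "br a a = 0" "br a b = - br b a" "br a (br b c) + br b (br c a) + br c (br a b) = 0"
proof -
  interpret l: Vector_Spaces.linear "(*s)" "(*s)" "\<lambda>a. br a c" for c
    using assms by (simp add: lie_algebra_def)
  interpret r: Vector_Spaces.linear "(*s)" "(*s)" "\<lambda>b. br c b" for c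
    using assms by (simp add: lie_algebra_def)
  show "Vector_Spaces.linear (*s) (*s) (\<lambda>b. br a b)" "Vector_Spaces.linear (*s) (*s) (\<lambda>a. br a b)"
    "br a a = 0" "br a (br b c) + br b (br c a) + br c (br a b) = 0"
    using assms by (simp_all add: lie_algebra_def)
  have alt: "br x x = 0" for x using assms by (simp add: lie_algebra_def)
  have "br (a + b) (a + b) = br a a + br b a + (br a b + br b b)"
    by (simp only: l.add r.add)
  then have "br a b + br b a = 0" by (simp add: alt add.commute)
  then show "br a b = - br b a" by (rule eq_neg_iff_add_eq_0[THEN iffD2])
qed

lemma scalar_product_linear:
  fixes p :: "'k::field ^ 'm::finite"
  shows "scalar_product p (x + y) = scalar_product p x + scalar_product p y"
    "scalar_product p (c *s x) = c * scalar_product p x"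
    "scalar_product p (- x) = - scalar_product p x"
    "scalar_product p 0 = 0"
  by (simp_all add: scalar_product_def algebra_simps sum.distrib sum_distrib_left sum_negf)

lemma alternating_lie_poisson:
  assumes "lie_algebra br"
  shows "alternating_form2 (lie_poisson br p)"
  using lie_algebraD(1-3)[OF assms]
  unfolding alternating_form2_def Vector_Spaces.linear_iff lie_poisson_def
  by (simp add: scalar_product_linear vector_space_over_itself.vector_space_axioms)

text \<open>
  The constant bi-vector \<open>\<Lambda>(p)\<close> is, up to sign, the differential of the linear form \<open>p\<close>;
  closedness is the Jacobi identity.
\<close>

lemma closed_lie_poisson:
  assumes br: "lie_algebra br"
  shows "ce_d2 br (lie_poisson br p) a b c = 0"
proof -
  have "lie_poisson br p (br x y) z = - scalar_product p (br z (br x y))" for x y z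
    unfolding lie_poisson_def by (subst lie_algebraD(4)[OF br]) (rule scalar_product_linear(3))
  moreover have "scalar_product p (br b (br a c)) = - scalar_product p (br b (br c a))"
  proof -
    interpret r: Vector_Spaces.linear "(*s)" "(*s)" "\<lambda>x. br b x"
      using br by (simp add: lie_algebra_def)
    show ?thesis
      by (subst lie_algebraD(4)[OF br, of a c]) (simp only: r.neg scalar_product_linear(3))
  qed
  moreover have "scalar_product p (br a (br b c)) + scalar_product p (br b (br c a)) +
      scalar_product p (br c (br a b)) = 0"
    unfolding scalar_product_linear(1)[symmetric]
    by (simp add: lie_algebraD(5)[OF br] scalar_product_linear(4))
  ultimately show ?thesis
    unfolding ce_d2_def by (simp add: algebra_simps)
qed

lemma linear_poisson_pair_add_lie_poisson:
  assumes br: "lie_algebra br" and pair: "linear_poisson_pair br \<Lambda> \<Lambda>1"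
  shows "linear_poisson_pair br \<Lambda> (\<lambda>x u v. \<Lambda>1 x u v + a * \<Lambda> p u v)"
proof -
  from pair obtain \<beta> where \<beta>: "\<Lambda> = lie_poisson br" "alternating_form2 \<beta>"
    "\<And>a b c. ce_d2 br \<beta> a b c = 0" "\<Lambda>1 = (\<lambda>_. \<beta>)"
    unfolding linear_poisson_pair_def by blast
  let ?\<beta>' = "\<lambda>u v. \<beta> u v + a * lie_poisson br p u v"
  have "alternating_form2 ?\<beta>'"
    using alternating_form2_add_mult[OF \<beta>(2) alternating_lie_poisson[OF br, of p], of 1 a] by simp
  moreover have "ce_d2 br ?\<beta>' x y z = ce_d2 br \<beta> x y z + a * ce_d2 br (lie_poisson br p) x y z" for x y z
    unfolding ce_d2_def by (simp add: algebra_simps)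
  ultimately show ?thesis
    unfolding linear_poisson_pair_def
    by (intro conjI exI[of _ ?\<beta>']) (simp_all add: \<beta> closed_lie_poisson[OF br])
qed

text \<open>
  The new couple spans the same pencil, up to the invertible change \<open>(s, t) \<mapsto> (s + a t, t)\<close>
  of parameters.
\<close>

lemma generic_couple_add_multiple:
  assumes \<iota>: "scalar_embedding \<iota>" and generic: "generic_couple \<iota> \<omega> \<omega>1"
  shows "generic_couple \<iota> \<omega> (\<lambda>u v. \<omega>1 u v + a * \<omega> u v)"
  unfolding generic_couple_def
proof (intro allI impI)
  fix s t :: complex assume "(s, t) \<noteq> (0, 0)"
  then have "(s + t * \<iota> a, t) \<noteq> (0, 0)" by auto
  moreover have "(\<lambda>u v. s * \<iota> (\<omega> u v) + t * \<iota> (\<omega>1 u v + a * \<omega> u v)) =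
      (\<lambda>u v. (s + t * \<iota> a) * \<iota> (\<omega> u v) + t * \<iota> (\<omega>1 u v))"
    by (simp add: scalar_embeddingD[OF \<iota>] algebra_simps)
  ultimately show "wedge_power2 (\<lambda>u v. s * \<iota> (\<omega> u v) + t * \<iota> (\<omega>1 u v + a * \<omega> u v))
      ((CARD('b) - 1) div 2) \<noteq> (\<lambda>_. 0)"
    using generic unfolding generic_couple_def by simp
qed

text \<open>
  The common vector from the divergence computation. The constant form \<open>\<beta>\<close> has divergence
  \<open>0\<close>, and the Lie--Poisson bi-vector has divergence \<open>\<Sum>\<^sub>k [e\<^sub>k, b]\<^sub>k = - tr (ad b)\<close>.
\<close>

lemma flat_modular_covector:
  fixes br :: "'k::real_normed_field ^ 'm::finite \<Rightarrow> 'k ^ 'm \<Rightarrow> 'k ^ 'm"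
  assumes reg: "\<And>V f. open V \<Longrightarrow> reg V f \<Longrightarrow> twice_differentiable_on V f"
    and br: "lie_algebra br" and \<beta>: "alternating_form2 \<beta>"
    and flat: "flat_at reg (lie_poisson br) (\<lambda>_. \<beta>) p"
  obtains v where "\<And>b. \<beta> v b = 0" "\<And>b. lie_poisson br p v b = - trace (matrix (br b))"
proof -
  note alt = alternating_lie_poisson[OF br]
  from flat obtain U \<phi> where coords: "local_coordinates reg p U \<phi>"
    and const: "constant_coefficients U \<phi> (lie_poisson br)" "constant_coefficients U \<phi> (\<lambda>_. \<beta>)"
    unfolding flat_at_def by blast
  from divergence_in_flat_coordinates[OF coords reg] obtain v where
    v: "\<And>\<Lambda> \<Lambda>' l. (\<And>x. x \<in> U \<Longrightarrow> alternating_form2 (\<Lambda> x)) \<Longrightarrow> constant_coefficients U \<phi> \<Lambda> \<Longrightarrow>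
      (\<And>k l. ((\<lambda>x. \<Lambda> x (axis k 1) (axis l 1)) has_derivative (\<lambda>h. \<Sum>s\<in>UNIV. \<Lambda>' s k l * h $ s)) (at p)) \<Longrightarrow>
      \<Lambda> p v (axis l 1) = (\<Sum>k\<in>UNIV. \<Lambda>' k k l)"
    by blast
  have "\<beta> v (axis l 1) = 0" for l
    using v[OF \<beta> const(2), of "\<lambda>_ _ _. 0"] by simp
  then have 1: "\<beta> v b = 0" for b
    unfolding alternating_form2_coordinates[OF \<beta>, of v b] by simp
  have "((\<lambda>x. lie_poisson br x (axis k 1) (axis l 1)) has_derivative
      (\<lambda>h. \<Sum>s\<in>UNIV. br (axis k 1) (axis l 1) $ s * h $ s)) (at p)" for k l
  proof -
    have "((\<lambda>x. \<Sum>s\<in>UNIV. x $ s * br (axis k 1) (axis l 1) $ s) has_derivative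
        (\<lambda>h. \<Sum>s\<in>UNIV. h $ s * br (axis k 1) (axis l 1) $ s)) (at p)"
      by (intro has_derivative_sum has_derivative_mult_left bounded_linear_imp_has_derivative
          bounded_linear_vec_nth)
    then show ?thesis
      by (simp add: lie_poisson_def scalar_product_def mult.commute)
  qed
  from v[OF alt const(1) this]
  have div: "lie_poisson br p v (axis l 1) = (\<Sum>k\<in>UNIV. br (axis k 1) (axis l 1) $ k)" for l .
  have "lie_poisson br p v b = - trace (matrix (br b))" for b
  proof -
    have "br b (axis k 1) = (\<Sum>l\<in>UNIV. b $ l *s br (axis l 1) (axis k 1))" for k
    proof -
      interpret l: Vector_Spaces.linear "(*s)" "(*s)" "\<lambda>x. br x (axis k 1)"
        by (rule lie_algebraD(2)[OF br])
      have "br b (axis k 1) = br (\<Sum>l\<in>UNIV. b $ l *s axis l 1) (axis k 1)"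
        by (simp add: basis_expansion)
      then show ?thesis by (simp only: l.sum l.scale)
    qed
    then have "trace (matrix (br b)) = (\<Sum>k\<in>UNIV. \<Sum>l\<in>UNIV. b $ l * br (axis l 1) (axis k 1) $ k)"
      unfolding trace_def matrix_def by simp
    also have "\<dots> = (\<Sum>k\<in>UNIV. \<Sum>l\<in>UNIV. - (br (axis k 1) (axis l 1) $ k * b $ l))"
      by (intro sum.cong refl, subst lie_algebraD(4)[OF br]) (simp add: mult.commute)
    also have "\<dots> = - (\<Sum>l\<in>UNIV. \<Sum>k\<in>UNIV. br (axis k 1) (axis l 1) $ k * b $ l)"
      unfolding sum_negf by (subst sum.swap) (rule refl)
    also have "(\<Sum>l\<in>UNIV. \<Sum>k\<in>UNIV. br (axis k 1) (axis l 1) $ k * b $ l) = lie_poisson br p v b"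
      unfolding alternating_form2_coordinates[OF alt, of p v b] div sum_distrib_right ..
    finally show ?thesis by simp
  qed
  with 1 show thesis by (rule that)
qed

lemma perturbed_pair_generic_not_flat:
  fixes br :: "'k::real_normed_field ^ 'm::finite \<Rightarrow> 'k ^ 'm \<Rightarrow> 'k ^ 'm"
  assumes card: "odd CARD('m)" "CARD('m) \<ge> 5"
    and \<iota>: "scalar_embedding \<iota>"
    and reg: "\<And>V f. open V \<Longrightarrow> reg V f \<Longrightarrow> twice_differentiable_on V f"
    and br: "lie_algebra br" "\<not> unimodular br"
    and pair: "linear_poisson_pair br \<Lambda> \<Lambda>1"
    and generic: "generic_at \<iota> \<Lambda> \<Lambda>1 p" and flat: "flat_at reg \<Lambda> \<Lambda>1 p"
    and a: "a \<noteq> 0"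
  defines "\<Lambda>1' \<equiv> \<lambda>x u v. \<Lambda>1 x u v + a * \<Lambda> p u v"
  shows "linear_poisson_pair br \<Lambda> \<Lambda>1'" "generic_at \<iota> \<Lambda> \<Lambda>1' p" "\<not> flat_at reg \<Lambda> \<Lambda>1' p"
proof -
  from pair obtain \<beta> where \<beta>: "alternating_form2 \<beta>" "\<Lambda>1 = (\<lambda>_. \<beta>)" and \<Lambda>: "\<Lambda> = lie_poisson br"
    unfolding linear_poisson_pair_def by blast
  show pair': "linear_poisson_pair br \<Lambda> \<Lambda>1'"
    unfolding \<Lambda>1'_def by (rule linear_poisson_pair_add_lie_poisson[OF br(1) pair])
  show "generic_at \<iota> \<Lambda> \<Lambda>1' p"
    using generic_couple_add_multiple[OF \<iota>] generic unfolding generic_at_def \<Lambda>1'_def by blast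
  show "\<not> flat_at reg \<Lambda> \<Lambda>1' p"
  proof
    assume flat': "flat_at reg \<Lambda> \<Lambda>1' p"
    define \<omega> where "\<omega> = lie_poisson br p"
    have \<omega>: "alternating_form2 \<omega>" unfolding \<omega>_def by (rule alternating_lie_poisson[OF br(1)])
    obtain v where v: "\<And>b. \<beta> v b = 0" "\<And>b. \<omega> v b = - trace (matrix (br b))"
      using flat_modular_covector[OF reg br(1) \<beta>(1) flat[unfolded \<Lambda> \<beta>(2)]] unfolding \<omega>_def by blast
    have \<beta>': "alternating_form2 (\<lambda>u v. \<beta> u v + a * \<omega> u v)"
      using alternating_form2_add_mult[OF \<beta>(1) \<omega>, of 1 a] by simp
    obtain w where w: "\<And>b. \<beta> w b + a * \<omega> w b = 0" "\<And>b. \<omega> w b = - trace (matrix (br b))"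
      using flat_modular_covector[OF reg br(1) \<beta>' flat'[unfolded \<Lambda>1'_def \<Lambda> \<beta>(2), folded \<omega>_def]]
      unfolding \<omega>_def by blast
    obtain b where b: "\<omega> v b \<noteq> 0"
      using br(2) v(2) unfolding unimodular_def by auto
    let ?A = "complexify_form \<iota> \<beta>" and ?B = "complexify_form \<iota> \<omega>" and ?c = "complexify_vec \<iota>"
    note left = complexify_form_left[OF \<iota> \<beta>(1)] complexify_form_left[OF \<iota> \<omega>]
    show False
    proof (rule no_kernel_line_of_degree_one[where A = ?A and B = ?B and v = "?c v" and w = "?c w"
          and a = "\<iota> a" and e = "?c b"])
      show "alternating_form2 ?A" "alternating_form2 ?B"
        by (intro alternating_complexify_form \<iota> \<beta> \<omega>)+
      show "CARD('m) \<ge> 4" using card by simp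
      show "kernel_at_most_line (\<lambda>x y. s * ?A x y + t * ?B x y)" if "(s, t) \<noteq> (0, 0)" for s t
        using generic_couple_kernel_at_most_line[OF card(1) _ \<iota> \<omega> \<beta>(1), of t s] that card(2) generic
        by (auto simp: generic_at_def \<Lambda> \<beta>(2) \<omega>_def add.commute)
      show "?A (?c v) y = 0" for y
        by (simp add: left v scalar_embeddingD[OF \<iota>])
      show "?B (?c w) y = ?B (?c v) y" for y
        by (simp add: left v w)
      show "?A (?c w) y = - \<iota> a * ?B (?c v) y" for y
      proof -
        have "\<beta> w x = - (a * \<omega> v x)" for x
          using w(1)[of x] v(2)[of x] w(2)[of x] by (simp add: add_eq_0_iff)
        then show ?thesis
          by (simp add: left scalar_embeddingD[OF \<iota>] sum_distrib_left sum_negf mult.assoc)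
      qed
      show "\<iota> a \<noteq> 0" using a by (simp add: scalar_embeddingD[OF \<iota>])
      show "?B (?c v) (?c b) \<noteq> 0"
        using b by (simp add: complexify_form_complexify_vec[OF \<iota> \<omega>] scalar_embeddingD[OF \<iota>])
    qed
  qed
qed

text \<open>
  The signs in \<^const>\<open>ce_d1\<close> and \<^const>\<open>lie_poisson\<close> differ, so \<open>d\<alpha>\<close> is the value of \<open>\<Lambda>\<close> at \<open>- \<alpha>\<close>.
\<close>

lemma exists_generic_not_flat:
  fixes br :: "'k::real_normed_field ^ 'm::finite \<Rightarrow> 'k ^ 'm \<Rightarrow> 'k ^ 'm"
  assumes card: "odd CARD('m)" "CARD('m) \<ge> 5"
    and \<iota>: "scalar_embedding \<iota>"
    and reg: "\<And>V f. open V \<Longrightarrow> reg V f \<Longrightarrow> twice_differentiable_on V f"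
    and br: "lie_algebra br" "\<not> unimodular br"
    and generic: "generic_couple \<iota> (ce_d1 br \<alpha>) (ce_d1 br \<beta>)"
  shows "\<exists>\<Lambda> \<Lambda>1. linear_poisson_pair br \<Lambda> \<Lambda>1 \<and> generic_pair \<iota> \<Lambda> \<Lambda>1 \<and> \<not> flat_pair \<iota> reg \<Lambda> \<Lambda>1"
proof -
  let ?\<Lambda> = "lie_poisson br"
  let ?\<Lambda>1 = "\<lambda>_. lie_poisson br (- \<beta>)"
  have d1: "ce_d1 br \<gamma> = lie_poisson br (- \<gamma>)" for \<gamma>
    by (simp add: fun_eq_iff ce_d1_def lie_poisson_def scalar_product_def sum_negf)
  have pair: "linear_poisson_pair br ?\<Lambda> ?\<Lambda>1"
    unfolding linear_poisson_pair_def
    using alternating_lie_poisson[OF br(1)] closed_lie_poisson[OF br(1)] by blast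
  have at: "generic_at \<iota> ?\<Lambda> ?\<Lambda>1 (- \<alpha>)"
    using generic unfolding generic_at_def d1 .
  show ?thesis
  proof (cases "flat_at reg ?\<Lambda> ?\<Lambda>1 (- \<alpha>)")
    case True
    from perturbed_pair_generic_not_flat[OF card \<iota> reg br pair at True, of 1]
    show ?thesis unfolding generic_pair_def flat_pair_def by fastforce
  next
    case False
    with pair at show ?thesis unfolding generic_pair_def flat_pair_def by blast
  qed
qed

theorem proposition3:
  assumes "odd CARD('m::finite)" and "CARD('m) \<ge> 5"
  shows
    "(\<forall>(br :: real ^ 'm \<Rightarrow> real ^ 'm \<Rightarrow> real ^ 'm) \<Lambda> \<Lambda>1 p.
       lie_algebra br \<and> \<not> unimodular br \<and> linear_poisson_pair br \<Lambda> \<Lambda>1 \<and>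
       generic_at of_real \<Lambda> \<Lambda>1 p \<and> flat_at smooth_fun_on \<Lambda> \<Lambda>1 p \<longrightarrow>
       (\<forall>a. a \<noteq> 0 \<longrightarrow>
          (let \<Lambda>1' = (\<lambda>x u v. \<Lambda>1 x u v + a * \<Lambda> p u v) in
             linear_poisson_pair br \<Lambda> \<Lambda>1' \<and>
             generic_at of_real \<Lambda> \<Lambda>1' p \<and> \<not> flat_at smooth_fun_on \<Lambda> \<Lambda>1' p))) \<and>
     (\<forall>(br :: complex ^ 'm \<Rightarrow> complex ^ 'm \<Rightarrow> complex ^ 'm) \<Lambda> \<Lambda>1 p.
       lie_algebra br \<and> \<not> unimodular br \<and> linear_poisson_pair br \<Lambda> \<Lambda>1 \<and>
       generic_at (\<lambda>z. z) \<Lambda> \<Lambda>1 p \<and> flat_at holomorphic_fun_on \<Lambda> \<Lambda>1 p \<longrightarrow>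
       (\<forall>a. a \<noteq> 0 \<longrightarrow>
          (let \<Lambda>1' = (\<lambda>x u v. \<Lambda>1 x u v + a * \<Lambda> p u v) in
             linear_poisson_pair br \<Lambda> \<Lambda>1' \<and>
             generic_at (\<lambda>z. z) \<Lambda> \<Lambda>1' p \<and> \<not> flat_at holomorphic_fun_on \<Lambda> \<Lambda>1' p))) \<and>
     (\<forall>br :: real ^ 'm \<Rightarrow> real ^ 'm \<Rightarrow> real ^ 'm.
       lie_algebra br \<and> \<not> unimodular br \<and>
       (\<exists>\<alpha> \<beta>. generic_couple of_real (ce_d1 br \<alpha>) (ce_d1 br \<beta>)) \<longrightarrow>
       (\<exists>\<Lambda> \<Lambda>1. linear_poisson_pair br \<Lambda> \<Lambda>1 \<and>
          generic_pair of_real \<Lambda> \<Lambda>1 \<and> \<not> flat_pair of_real smooth_fun_on \<Lambda> \<Lambda>1)) \<and>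
     (\<forall>br :: complex ^ 'm \<Rightarrow> complex ^ 'm \<Rightarrow> complex ^ 'm.
       lie_algebra br \<and> \<not> unimodular br \<and>
       (\<exists>\<alpha> \<beta>. generic_couple (\<lambda>z. z) (ce_d1 br \<alpha>) (ce_d1 br \<beta>)) \<longrightarrow>
       (\<exists>\<Lambda> \<Lambda>1. linear_poisson_pair br \<Lambda> \<Lambda>1 \<and>
          generic_pair (\<lambda>z. z) \<Lambda> \<Lambda>1 \<and> \<not> flat_pair (\<lambda>z. z) holomorphic_fun_on \<Lambda> \<Lambda>1))"
proof -
  have real: "scalar_embedding (of_real :: real \<Rightarrow> complex)"
    and complex: "scalar_embedding (\<lambda>z. z :: complex)"
    by (simp_all add: scalar_embedding_def)
  have smooth: "twice_differentiable_on V f" if "open V" "smooth_fun_on V f" for V and f :: "real ^ 'm \<Rightarrow> real"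
    using that(2) by (rule smooth_imp_twice_differentiable)
  note real_case = perturbed_pair_generic_not_flat[OF assms real smooth]
    exists_generic_not_flat[OF assms real smooth]
  note complex_case = perturbed_pair_generic_not_flat[OF assms complex holomorphic_imp_twice_differentiable]
    exists_generic_not_flat[OF assms complex holomorphic_imp_twice_differentiable]
  show ?thesis
    unfolding Let_def
    by (intro conjI allI impI; elim conjE exE) (assumption | rule real_case complex_case)+
qed


end
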